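(* Let $W$, $X$, $Y$ and $Z$ be Banach lattices such that $X$ and $Y$ have order continuous norms and $Z$ is Dedekind complete. Then $$|M_{A, B}|=M_{|A|, |B|}$$ for all $A\in L^{r}(Y, Z)$ and all $B\in L^{r}(W, X)$.
   Context: Banach lattices are real. For a Riesz space $E$ and a Dedekind complete Riesz space $F$, $L^{r}(E,F)$ denotes the set of all regular operators from $E$ into $F$ (differences of two positive linear operators); ordered by $S\le T$ iff $T-S$ is positive, it is a Dedekind complete Riesz space. (A Banach lattice with order continuous norm is Dedekind complete.) For $A\in L^{r}(Y,Z)$ and $B\in L^{r}(W,X)$, the two-sided multiplication operator $M_{A,B}: L^{r}(X,Y)\to L^{r}(W,Z)$ is defined by $M_{A,B}(T)=ATB$. It is a regular operator, and its modulus $|M_{A,B}|$ is taken in the Dedekind complete Riesz space $L^{r}\big(L^{r}(X, Y), L^{r}(W, Z)\big)$. The moduli $|A|$ and $|B|$ are taken in $L^{r}(Y,Z)$ and $L^{r}(W,X)$ respectively. *)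

theory Defs
  imports "HOL-Analysis.Analysis" "HOL-Library.Lattice_Algebras"
begin

section \<open>Riesz spaces and Banach lattices\<close>

text \<open>
  The class \<^class>\<open>lattice_ab_group_add_abs\<close> provides the modulus of an element
  as \<open>\<bar>x\<bar> = sup x (- x)\<close>.
\<close>

declare neg_inf_eq_sup [simp del] neg_sup_eq_inf [simp del]
  diff_inf_eq_sup [simp del] diff_sup_eq_inf [simp del]

class riesz_space = ordered_real_vector + lattice_ab_group_add_abs

class dedekind_complete_riesz_space = riesz_space +
  assumes dedekind_complete:
    "S \<noteq> {} \<Longrightarrow> bdd_above S \<Longrightarrow>
      \<exists>s. (\<forall>x\<in>S. x \<le> s) \<and> (\<forall>u. (\<forall>x\<in>S. x \<le> u) \<longrightarrow> s \<le> u)"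

class banach_lattice = riesz_space + banach +
  assumes norm_lattice_mono: "\<bar>x\<bar> \<le> \<bar>y\<bar> \<Longrightarrow> norm x \<le> norm y"

text \<open>
  The norm is order continuous if every net decreasing to \<open>0\<close> in order converges to \<open>0\<close> in
  norm. The range of a decreasing net is a nonempty downward directed set with the same
  infimum, and conversely such a set, indexed by itself with the reversed order, is a
  decreasing net; hence nets are represented by downward directed sets \<open>D\<close>.
\<close>

class order_continuous_banach_lattice = banach_lattice +
  assumes order_continuous_norm:
    "D \<noteq> {} \<Longrightarrow> (\<forall>x\<in>D. \<forall>y\<in>D. \<exists>z\<in>D. z \<le> x \<and> z \<le> y) \<Longrightarrow>
     (\<forall>x\<in>D. 0 \<le> x) \<Longrightarrow> (\<forall>w. (\<forall>x\<in>D. w \<le> x) \<longrightarrow> w \<le> 0) \<Longrightarrow>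
     0 < e \<Longrightarrow> \<exists>d\<in>D. \<forall>x\<in>D. x \<le> d \<longrightarrow> norm x < e"

subsection \<open>Banach lattices with order continuous norm are Dedekind complete\<close>

lemma banach_lattice_nonneg_if_approx:
  fixes x :: "'a::banach_lattice"
  assumes "\<And>e. 0 < e \<Longrightarrow> \<exists>y\<ge>0. norm (y - x) < e"
  shows "0 \<le> x"
proof -
  have "norm (pprt (- x)) \<le> 0"
  proof (rule field_le_epsilon)
    fix e :: real assume "0 < e"
    then obtain y where y: "0 \<le> y" "norm (y - x) < e" using assms by blast
    have "- x \<le> y - x" using y(1) by simp
    then have "- x \<le> \<bar>y - x\<bar>" using abs_ge_self order_trans by blast
    then have "pprt (- x) \<le> \<bar>y - x\<bar>" by (simp add: pprt_def)
    then have "\<bar>pprt (- x)\<bar> \<le> \<bar>y - x\<bar>" by simp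
    then have "norm (pprt (- x)) \<le> norm (y - x)" by (rule norm_lattice_mono)
    with y(2) show "norm (pprt (- x)) \<le> 0 + e" by simp
  qed
  then have "pprt (- x) = 0" by simp
  then have "- x \<le> 0" by (simp only: le_zero_iff_zero_pprt)
  then show ?thesis by simp
qed

lemma banach_lattice_archimedean:
  fixes v w :: "'a::banach_lattice"
  assumes "\<And>n::nat. of_nat n *\<^sub>R w \<le> v"
  shows "w \<le> 0"
proof -
  have "0 \<le> - w"
  proof (rule banach_lattice_nonneg_if_approx)
    fix e :: real assume e: "0 < e"
    obtain n :: nat where n: "norm v / e < real n" using reals_Archimedean2 by blast
    then have n0: "0 < real n" using e by (meson divide_nonneg_pos norm_ge_zero order_le_less_trans)
    have "inverse (real n) *\<^sub>R (real n *\<^sub>R w) \<le> inverse (real n) *\<^sub>R v"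
      using assms[of n] n0 by (intro scaleR_left_mono) auto
    then have "w \<le> inverse (real n) *\<^sub>R v" using n0 by simp
    moreover have "norm (inverse (real n) *\<^sub>R v) < e"
      using n n0 e by (simp add: field_simps)
    ultimately show "\<exists>y\<ge>0. norm (y - (- w)) < e"
      by (intro exI[of _ "inverse (real n) *\<^sub>R v - w"]) auto
  qed
  then show ?thesis by simp
qed

instance order_continuous_banach_lattice \<subseteq> dedekind_complete_riesz_space
proof
  fix S :: "'a set"
  assume S: "S \<noteq> {}" "bdd_above S"
  define U where "U = {u. \<forall>x\<in>S. x \<le> u}"
  define L where "L = {l. \<forall>u\<in>U. l \<le> u}"
  define D where "D = {u - l | u l. u \<in> U \<and> l \<in> L}"
  have SL: "S \<subseteq> L" by (auto simp: U_def L_def)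
  obtain u0 where u0: "u0 \<in> U" using S(2) by (auto simp: U_def bdd_above_def)
  obtain l0 where l0: "l0 \<in> L" using S(1) SL by auto
  have D0: "D \<noteq> {}" using u0 l0 by (auto simp: D_def)
  have Ddir: "\<forall>x\<in>D. \<forall>y\<in>D. \<exists>z\<in>D. z \<le> x \<and> z \<le> y"
  proof (intro ballI)
    fix x y assume "x \<in> D" "y \<in> D"
    then obtain u l u' l' where
      *: "x = u - l" "u \<in> U" "l \<in> L" "y = u' - l'" "u' \<in> U" "l' \<in> L"
      by (auto simp: D_def)
    have "inf u u' \<in> U" using * by (auto simp: U_def)
    moreover have "sup l l' \<in> L" using * by (auto simp: L_def)
    ultimately have "inf u u' - sup l l' \<in> D" by (auto simp: D_def)
    moreover have "inf u u' - sup l l' \<le> x" "inf u u' - sup l l' \<le> y"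
      unfolding * by (intro diff_mono; simp)+
    ultimately show "\<exists>z\<in>D. z \<le> x \<and> z \<le> y" by blast
  qed
  have Dpos: "\<forall>x\<in>D. 0 \<le> x" by (auto simp: D_def L_def)
  have Dinf: "\<forall>w. (\<forall>x\<in>D. w \<le> x) \<longrightarrow> w \<le> 0"
  proof (intro allI impI)
    fix w assume w: "\<forall>x\<in>D. w \<le> x"
    have step: "u - w \<in> U" if "u \<in> U" for u
      unfolding U_def
    proof (intro CollectI ballI)
      fix x assume "x \<in> S"
      then have "u - x \<in> D" using SL that by (auto simp: D_def)
      with w have "w \<le> u - x" by blast
      then show "x \<le> u - w" by (simp add: algebra_simps)
    qed
    have "u0 - of_nat n *\<^sub>R w \<in> U" for n :: nat
    proof (induction n)
      case (Suc n)
      from step[OF Suc] show ?case by (simp add: algebra_simps)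
    qed (simp add: u0)
    then have "l0 \<le> u0 - of_nat n *\<^sub>R w" for n :: nat
      using l0 by (auto simp: L_def)
    then have "of_nat n *\<^sub>R w \<le> u0 - l0" for n :: nat
      by (simp add: algebra_simps)
    then show "w \<le> 0" by (rule banach_lattice_archimedean)
  qed
  have "\<exists>u l. u \<in> U \<and> l \<in> L \<and> norm (u - l) < e" if "0 < e" for e :: real
  proof -
    obtain d where "d \<in> D" "norm d < e"
      using order_continuous_norm[OF D0 Ddir Dpos Dinf \<open>0 < e\<close>] by blast
    then show ?thesis unfolding D_def by blast
  qed
  then have "\<forall>n. \<exists>u l. u \<in> U \<and> l \<in> L \<and> norm (u - l) < inverse (real (Suc n))"
    by simp
  then obtain u l where ul:
    "\<And>n. u n \<in> U" "\<And>n. l n \<in> L" "\<And>n. norm (u n - l n) < inverse (real (Suc n))"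
    by metis
  have small: "\<exists>N. \<forall>n\<ge>N. norm (u n - l n) < e" if "0 < e" for e
  proof -
    obtain N where N: "inverse (real (Suc N)) < e" using reals_Archimedean \<open>0 < e\<close> by blast
    have "norm (u n - l n) < e" if "n \<ge> N" for n
    proof -
      have "inverse (real (Suc n)) \<le> inverse (real (Suc N))" using that by simp
      with ul(3)[of n] N show ?thesis by linarith
    qed
    then show ?thesis by blast
  qed
  have dist_le: "norm (u m - u n) \<le> norm (u m - l m) + norm (u n - l n)" for m n
  proof -
    have le: "l i \<le> u j" for i j using ul(1)[of j] ul(2)[of i] by (auto simp: L_def)
    have nn: "0 \<le> u i - l i" for i using le by simp
    have "u m - u n \<le> (u m - l m) + (u n - l n)"
      using add_increasing2[OF nn[of n], of "u m - u n" "u m - l m"] le[of m n] by (simp add: diff_mono)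
    moreover have "- (u m - u n) \<le> (u m - l m) + (u n - l n)"
      using add_increasing[OF nn[of m], of "u n - u m" "u n - l n"] le[of n m] by (simp add: diff_mono)
    ultimately have "\<bar>u m - u n\<bar> \<le> (u m - l m) + (u n - l n)" by (rule abs_leI)
    then have "\<bar>u m - u n\<bar> \<le> \<bar>(u m - l m) + (u n - l n)\<bar>" using nn by (simp add: abs_of_nonneg)
    then have "norm (u m - u n) \<le> norm ((u m - l m) + (u n - l n))" by (rule norm_lattice_mono)
    also have "\<dots> \<le> norm (u m - l m) + norm (u n - l n)" by (rule norm_triangle_ineq)
    finally show ?thesis .
  qed
  have "Cauchy u"
  proof (rule CauchyI)
    fix e :: real assume "0 < e"
    then obtain N where N: "\<And>n. n \<ge> N \<Longrightarrow> norm (u n - l n) < e / 2" using small[of "e/2"] by auto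
    show "\<exists>M. \<forall>m\<ge>M. \<forall>n\<ge>M. norm (u m - u n) < e"
    proof (intro exI allI impI)
      fix m n assume "N \<le> m" "N \<le> n"
      then show "norm (u m - u n) < e" using dist_le[of m n] N[of m] N[of n] by linarith
    qed
  qed
  then obtain s where s: "u \<longlonglongrightarrow> s" using Cauchy_convergent convergent_def by blast
  have usmall: "\<exists>N. \<forall>n\<ge>N. norm (u n - s) < e" if "0 < e" for e
    using s that LIMSEQ_iff by blast
  have up: "x \<le> s" if "x \<in> S" for x
  proof -
    have "0 \<le> s - x"
    proof (rule banach_lattice_nonneg_if_approx)
      fix e :: real assume "0 < e"
      then obtain n where "norm (u n - s) < e" using usmall by blast
      moreover have "0 \<le> u n - x" using ul(1)[of n] that by (auto simp: U_def)
      ultimately show "\<exists>y\<ge>0. norm (y - (s - x)) < e"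
        by (intro exI[of _ "u n - x"]) auto
    qed
    then show ?thesis by simp
  qed
  have least: "s \<le> v" if "\<forall>x\<in>S. x \<le> v" for v
  proof -
    have v: "v \<in> U" using that by (simp add: U_def)
    have "0 \<le> v - s"
    proof (rule banach_lattice_nonneg_if_approx)
      fix e :: real assume "0 < e"
      then have "0 < e / 2" by simp
      then obtain N M where N: "\<And>n. n \<ge> N \<Longrightarrow> norm (u n - s) < e / 2"
        and M: "\<And>n. n \<ge> M \<Longrightarrow> norm (u n - l n) < e / 2"
        using usmall small by meson
      define n where "n = max N M"
      have "0 \<le> v - l n" using v ul(2)[of n] by (auto simp: L_def)
      moreover have "norm ((v - l n) - (v - s)) < e"
      proof -
        have "(v - l n) - (v - s) = (u n - l n) - (u n - s)" by simp
        then have "norm ((v - l n) - (v - s)) \<le> norm (u n - l n) + norm (u n - s)"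
          by (metis norm_triangle_ineq4)
        also have "\<dots> < e" using N[of n] M[of n] by (simp add: n_def)
        finally show ?thesis .
      qed
      ultimately show "\<exists>y\<ge>0. norm (y - (v - s)) < e" by blast
    qed
    then show ?thesis by simp
  qed
  show "\<exists>s. (\<forall>x\<in>S. x \<le> s) \<and> (\<forall>u. (\<forall>x\<in>S. x \<le> u) \<longrightarrow> s \<le> u)"
    using up least by blast
qed

section \<open>Regular operators\<close>

definition positive_op :: "('a::riesz_space \<Rightarrow> 'b::riesz_space) \<Rightarrow> bool" where
  "positive_op T \<longleftrightarrow> linear T \<and> (\<forall>x\<ge>0. 0 \<le> T x)"

definition regular_op :: "('a::riesz_space \<Rightarrow> 'b::riesz_space) \<Rightarrow> bool" where
  "regular_op T \<longleftrightarrow> (\<exists>P Q. positive_op P \<and> positive_op Q \<and> T = (\<lambda>x. P x - Q x))"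

lemma positive_op_zero: "positive_op (\<lambda>x. 0)"
  by (auto simp: positive_op_def linear_iff)

lemma positive_op_add: "positive_op P \<Longrightarrow> positive_op Q \<Longrightarrow> positive_op (\<lambda>x. P x + Q x)"
  by (auto simp: positive_op_def linear_iff algebra_simps)

lemma positive_op_scaleR: "positive_op P \<Longrightarrow> 0 \<le> c \<Longrightarrow> positive_op (\<lambda>x. c *\<^sub>R P x)"
  by (auto simp: positive_op_def linear_iff algebra_simps scaleR_nonneg_nonneg)

lemma positive_op_comp: "positive_op P \<Longrightarrow> positive_op Q \<Longrightarrow> positive_op (\<lambda>x. P (Q x))"
  by (auto simp: positive_op_def linear_iff)

lemma regular_op_linear: "regular_op T \<Longrightarrow> linear T"
  by (auto simp: regular_op_def positive_op_def linear_iff algebra_simps)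

lemma regular_opI: "positive_op P \<Longrightarrow> positive_op Q \<Longrightarrow> (\<And>x. T x = P x - Q x) \<Longrightarrow> regular_op T"
  unfolding regular_op_def by blast

lemma regular_opE:
  assumes "regular_op T"
  obtains P Q where "positive_op P" "positive_op Q" "\<And>x. T x = P x - Q x"
  using assms unfolding regular_op_def by auto

lemma regular_op_positive: "positive_op P \<Longrightarrow> regular_op P"
  by (rule regular_opI[OF _ positive_op_zero]) auto

lemma regular_op_zero: "regular_op (\<lambda>x. 0)"
  by (intro regular_op_positive positive_op_zero)

lemma regular_op_add: "regular_op S \<Longrightarrow> regular_op T \<Longrightarrow> regular_op (\<lambda>x. S x + T x)"
  by (elim regular_opE, rule regular_opI, erule (1) positive_op_add, rotate_tac 1,
      erule (1) positive_op_add) simp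

lemma regular_op_minus: "regular_op T \<Longrightarrow> regular_op (\<lambda>x. - T x)"
  by (elim regular_opE, rule regular_opI) auto

lemma regular_op_diff: "regular_op S \<Longrightarrow> regular_op T \<Longrightarrow> regular_op (\<lambda>x. S x - T x)"
  using regular_op_add[OF _ regular_op_minus] by fastforce

lemma regular_op_scaleR:
  assumes "regular_op T"
  shows "regular_op (\<lambda>x. c *\<^sub>R T x)"
proof -
  obtain P Q where *: "positive_op P" "positive_op Q" "\<And>x. T x = P x - Q x"
    using assms by (auto elim: regular_opE)
  show ?thesis
  proof (cases "0 \<le> c")
    case True
    then show ?thesis
      by (intro regular_opI[OF positive_op_scaleR[OF *(1), of c] positive_op_scaleR[OF *(2), of c]])
        (auto simp: * algebra_simps)
  next
    case False
    then show ?thesis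
      by (intro regular_opI[OF positive_op_scaleR[OF *(2), of "-c"] positive_op_scaleR[OF *(1), of "-c"]])
        (auto simp: * algebra_simps)
  qed
qed

lemma regular_op_comp:
  assumes "regular_op S" "regular_op T"
  shows "regular_op (\<lambda>x. S (T x))"
proof -
  obtain P Q where *: "positive_op P" "positive_op Q" "\<And>x. S x = P x - Q x"
    using assms by (auto elim: regular_opE)
  obtain P' Q' where **: "positive_op P'" "positive_op Q'" "\<And>x. T x = P' x - Q' x"
    using assms by (auto elim: regular_opE)
  have "linear P" "linear Q" using * by (auto simp: positive_op_def)
  then show ?thesis
    by (intro regular_opI[OF positive_op_add[OF positive_op_comp[OF *(1) **(1)] positive_op_comp[OF *(2) **(2)]]
        positive_op_add[OF positive_op_comp[OF *(1) **(2)] positive_op_comp[OF *(2) **(1)]]])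
      (simp add: * ** linear_diff)
qed

typedef (overloaded) ('a::riesz_space, 'b::riesz_space) regop = "{T :: 'a \<Rightarrow> 'b. regular_op T}"
  morphisms regop_apply Regop
  using regular_op_zero by blast

setup_lifting type_definition_regop

lemma regular_op_regop_apply: "regular_op (regop_apply T)"
  using regop_apply by blast

lemma linear_regop_apply: "linear (regop_apply T)"
  by (intro regular_op_linear regular_op_regop_apply)

lemma regop_eqI: "(\<And>x. regop_apply S x = regop_apply T x) \<Longrightarrow> S = T"
  by (simp add: ext flip: regop_apply_inject)

lemma riesz_pos_neg: "(x::'a::riesz_space) = pprt x - pprt (- x)"
  using prts[of x] by (simp add: pprt_neg)

lemma regop_eqI_nonneg:
  assumes "\<And>x. 0 \<le> x \<Longrightarrow> regop_apply S x = regop_apply T x"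
  shows "S = T"
proof (rule regop_eqI)
  fix x :: 'a
  show "regop_apply S x = regop_apply T x"
    using assms by (subst (1 2) riesz_pos_neg) (simp add: linear_diff[OF linear_regop_apply])
qed

instantiation regop :: (riesz_space, riesz_space) real_vector
begin

lift_definition zero_regop :: "('a, 'b) regop" is "\<lambda>x. 0" by (rule regular_op_zero)
lift_definition plus_regop :: "('a, 'b) regop \<Rightarrow> ('a, 'b) regop \<Rightarrow> ('a, 'b) regop"
  is "\<lambda>S T x. S x + T x" by (rule regular_op_add)
lift_definition minus_regop :: "('a, 'b) regop \<Rightarrow> ('a, 'b) regop \<Rightarrow> ('a, 'b) regop"
  is "\<lambda>S T x. S x - T x" by (rule regular_op_diff)
lift_definition uminus_regop :: "('a, 'b) regop \<Rightarrow> ('a, 'b) regop"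
  is "\<lambda>T x. - T x" by (rule regular_op_minus)
lift_definition scaleR_regop :: "real \<Rightarrow> ('a, 'b) regop \<Rightarrow> ('a, 'b) regop"
  is "\<lambda>c T x. c *\<^sub>R T x" by (rule regular_op_scaleR)

instance
  by standard (transfer; simp add: fun_eq_iff algebra_simps)+

end

instantiation regop :: (riesz_space, riesz_space) ordered_real_vector
begin

lift_definition less_eq_regop :: "('a, 'b) regop \<Rightarrow> ('a, 'b) regop \<Rightarrow> bool"
  is "\<lambda>S T. positive_op (\<lambda>x. T x - S x)" .

definition less_regop :: "('a, 'b) regop \<Rightarrow> ('a, 'b) regop \<Rightarrow> bool" where
  "less_regop S T \<longleftrightarrow> S \<le> T \<and> \<not> T \<le> S"

lemma regop_le_iff: "S \<le> T \<longleftrightarrow> (\<forall>x\<ge>0. regop_apply S x \<le> regop_apply T x)"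
  for S T :: "('a, 'b) regop"
  by transfer (auto simp: positive_op_def dest: regular_op_linear intro: linear_compose_sub)

instance
proof
  fix S T U :: "('a, 'b) regop" and c d :: real
  show "S < T \<longleftrightarrow> S \<le> T \<and> \<not> T \<le> S" by (rule less_regop_def)
  show "S \<le> S" by (simp add: regop_le_iff)
  show "S \<le> T \<Longrightarrow> T \<le> U \<Longrightarrow> S \<le> U" unfolding regop_le_iff by (meson order_trans)
  show "S \<le> T \<Longrightarrow> T \<le> S \<Longrightarrow> S = T" 
    unfolding regop_le_iff by (intro regop_eqI_nonneg) (meson order_antisym)
  show "S \<le> T \<Longrightarrow> U + S \<le> U + T" by (simp add: regop_le_iff plus_regop.rep_eq)
  show "S \<le> T \<Longrightarrow> 0 \<le> c \<Longrightarrow> c *\<^sub>R S \<le> c *\<^sub>R T"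
    by (simp add: regop_le_iff scaleR_regop.rep_eq scaleR_left_mono)
  show "c \<le> d \<Longrightarrow> 0 \<le> S \<Longrightarrow> c *\<^sub>R S \<le> d *\<^sub>R S"
    by (simp add: regop_le_iff scaleR_regop.rep_eq zero_regop.rep_eq scaleR_right_mono)
qed

end

subsection \<open>The lattice structure for a Dedekind complete codomain\<close>

lemma riesz_decomposition:
  fixes p q x y :: "'a::riesz_space"
  assumes "0 \<le> p" "0 \<le> q" "0 \<le> x" "0 \<le> y" "p + q = x + y"
  obtains p1 p2 q1 q2 where "0 \<le> p1" "0 \<le> p2" "0 \<le> q1" "0 \<le> q2"
    "p = p1 + p2" "q = q1 + q2" "x = p1 + q1" "y = p2 + q2"
proof
  let ?p1 = "inf p x"
  show "0 \<le> ?p1" "0 \<le> p - ?p1" "0 \<le> x - ?p1" using assms by simp_all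
  have q: "q = x + y - p" using assms(5) by (simp add: algebra_simps)
  have "y - (p - ?p1) = inf p x + (y - p)" by (simp add: algebra_simps)
  also have "\<dots> = inf (p + (y - p)) (x + (y - p))" by (rule add_inf_distrib_right)
  also have "\<dots> = inf y q" by (simp add: q add_diff_eq)
  finally show "0 \<le> y - (p - ?p1)" using assms by simp
  show "p = ?p1 + (p - ?p1)" "x = ?p1 + (x - ?p1)" "y = (p - ?p1) + (y - (p - ?p1))"
    by simp_all
  show "q = (x - ?p1) + (y - (p - ?p1))" by (simp add: q algebra_simps)
qed

lemma cone_map_extension:
  fixes r :: "'a::riesz_space \<Rightarrow> 'b::riesz_space"
  assumes add: "\<And>x y. 0 \<le> x \<Longrightarrow> 0 \<le> y \<Longrightarrow> r (x + y) = r x + r y"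
    and scale: "\<And>c x. 0 \<le> c \<Longrightarrow> 0 \<le> x \<Longrightarrow> r (c *\<^sub>R x) = c *\<^sub>R r x"
  obtains R where "linear R" "\<And>x. 0 \<le> x \<Longrightarrow> R x = r x"
proof
  define R where "R x = r (pprt x) - r (pprt (- x))" for x :: 'a
  have R: "R x = r a - r b" if "0 \<le> a" "0 \<le> b" "x = a - b" for x a b :: 'a
  proof -
    have "pprt x + b = a + pprt (- x)"
      using riesz_pos_neg[of x] that(3) by (metis add.commute add_diff_eq diff_eq_eq diff_add_eq)
    then have "r (pprt x) + r b = r a + r (pprt (- x))"
      using add[of "pprt x" b] add[of a "pprt (- x)"] that by (simp del: pprt_neg)
    then show ?thesis unfolding R_def by (simp add: algebra_simps)
  qed
  have r0: "r 0 = 0" using scale[of 0 0] by simp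
  show "R x = r x" if "0 \<le> x" for x :: 'a using R[of x 0 x] that r0 by simp
  have Rscale: "R (c *\<^sub>R x) = c *\<^sub>R R x" if "0 \<le> c" for c and x :: 'a
  proof -
    have "c *\<^sub>R x = c *\<^sub>R pprt x - c *\<^sub>R pprt (- x)"
      by (subst riesz_pos_neg[of x]) (simp add: scaleR_diff_right)
    then have "R (c *\<^sub>R x) = r (c *\<^sub>R pprt x) - r (c *\<^sub>R pprt (- x))"
      using that by (intro R) (auto intro: scaleR_nonneg_nonneg)
    then show ?thesis using that by (simp add: scale R_def scaleR_diff_right)
  qed
  have Rminus: "R (- x) = - R x" for x :: 'a by (simp add: R_def)
  show "linear R"
  proof (rule linearI)
    fix x y :: 'a
    have "x + y = (pprt x + pprt y) - (pprt (- x) + pprt (- y))"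
      by (subst riesz_pos_neg[of x], subst riesz_pos_neg[of y]) simp
    then have "R (x + y) = r (pprt x + pprt y) - r (pprt (- x) + pprt (- y))"
      by (intro R) auto
    then show "R (x + y) = R x + R y" by (simp add: add R_def)
  next
    fix c and x :: 'a
    show "R (c *\<^sub>R x) = c *\<^sub>R R x"
    proof (cases "0 \<le> c")
      case False
      have "R (c *\<^sub>R x) = - R ((- c) *\<^sub>R x)" using Rminus[of "(- c) *\<^sub>R x"] by simp
      then show ?thesis using Rscale[of "- c" x] False by simp
    qed (rule Rscale)
  qed
qed

text \<open>
  The Riesz--Kantorovich formula: the supremum of a set \<open>S\<close> of operators at \<open>x \<ge> 0\<close> is the
  supremum of the values \<open>T\<^sub>1 x\<^sub>1 + \<dots> + T\<^sub>n x\<^sub>n\<close> with \<open>T\<^sub>i \<in> S\<close>, \<open>x\<^sub>i \<ge> 0\<close> and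
  \<open>x\<^sub>1 + \<dots> + x\<^sub>n = x\<close>.
\<close>

inductive rk_value :: "('a::riesz_space, 'b::riesz_space) regop set \<Rightarrow> 'a \<Rightarrow> 'b \<Rightarrow> bool"
  for S where
  base: "T \<in> S \<Longrightarrow> 0 \<le> x \<Longrightarrow> rk_value S x (regop_apply T x)"
| add: "rk_value S x v \<Longrightarrow> rk_value S y w \<Longrightarrow> rk_value S (x + y) (v + w)"

lemma rk_value_nonneg: "rk_value S x v \<Longrightarrow> 0 \<le> x"
  by (induction rule: rk_value.induct) auto

lemma rk_value_upper:
  assumes "rk_value S x v" "\<And>T. T \<in> S \<Longrightarrow> T \<le> U"
  shows "v \<le> regop_apply U x"
  using assms
  by (induction rule: rk_value.induct)
    (auto simp: regop_le_iff linear_add[OF linear_regop_apply] intro: add_mono)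

lemma rk_value_scale: "rk_value S x v \<Longrightarrow> 0 \<le> c \<Longrightarrow> rk_value S (c *\<^sub>R x) (c *\<^sub>R v)"
proof (induction rule: rk_value.induct)
  case (base T x)
  then have "rk_value S (c *\<^sub>R x) (regop_apply T (c *\<^sub>R x))"
    by (intro rk_value.base scaleR_nonneg_nonneg)
  then show ?case by (simp add: linear_scale[OF linear_regop_apply])
next
  case (add x v y w)
  then show ?case by (simp add: scaleR_add_right rk_value.add)
qed

lemma rk_value_split:
  assumes "rk_value S z v" "0 \<le> x" "0 \<le> y" "z = x + y"
  shows "\<exists>v1 v2. rk_value S x v1 \<and> rk_value S y v2 \<and> v = v1 + v2"
  using assms
proof (induction arbitrary: x y rule: rk_value.induct)
  case (base T z)
  then show ?case
    using rk_value.base[of T S x] rk_value.base[of T S y]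
    by (auto simp: linear_add[OF linear_regop_apply])
next
  case (add p v q w)
  have "0 \<le> p" "0 \<le> q" using add.hyps rk_value_nonneg by auto
  with add.prems obtain p1 p2 q1 q2 where
    *: "0 \<le> p1" "0 \<le> p2" "0 \<le> q1" "0 \<le> q2" "p = p1 + p2" "q = q1 + q2" "x = p1 + q1" "y = p2 + q2"
    using riesz_decomposition[of p q x y] by metis
  obtain v1 v2 where v: "rk_value S p1 v1" "rk_value S p2 v2" "v = v1 + v2"
    using add.IH(1)[OF *(1,2,5)] by blast
  obtain w1 w2 where w: "rk_value S q1 w1" "rk_value S q2 w2" "w = w1 + w2"
    using add.IH(2)[OF *(3,4,6)] by blast
  have "rk_value S x (v1 + w1)" "rk_value S y (v2 + w2)"
    unfolding * using v w by (auto intro: rk_value.add)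
  moreover have "v + w = (v1 + w1) + (v2 + w2)" using v w by (simp add: algebra_simps)
  ultimately show ?case by blast
qed

lemma regop_dedekind_complete:
  fixes S :: "('a::riesz_space, 'b::dedekind_complete_riesz_space) regop set"
  assumes "S \<noteq> {}" "\<forall>T\<in>S. T \<le> U"
  shows "\<exists>R. (\<forall>T\<in>S. T \<le> R) \<and> (\<forall>V. (\<forall>T\<in>S. T \<le> V) \<longrightarrow> R \<le> V)"
proof -
  obtain T0 where T0: "T0 \<in> S" using assms by blast
  have "\<exists>s. (\<forall>v. rk_value S x v \<longrightarrow> v \<le> s) \<and> (\<forall>u. (\<forall>v. rk_value S x v \<longrightarrow> v \<le> u) \<longrightarrow> s \<le> u)"
    if "0 \<le> x" for x
  proof -
    have "{v. rk_value S x v} \<noteq> {}" using rk_value.base[OF T0 that] by blast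
    moreover have "bdd_above {v. rk_value S x v}"
      using rk_value_upper assms(2) by (intro bdd_aboveI[of _ "regop_apply U x"]) blast
    ultimately show ?thesis using dedekind_complete[of "{v. rk_value S x v}"] by simp
  qed
  then obtain r where
    up: "\<And>x v. 0 \<le> x \<Longrightarrow> rk_value S x v \<Longrightarrow> v \<le> r x" and
    least: "\<And>x u. 0 \<le> x \<Longrightarrow> (\<And>v. rk_value S x v \<Longrightarrow> v \<le> u) \<Longrightarrow> r x \<le> u"
    by metis
  have radd: "r (x + y) = r x + r y" if xy: "0 \<le> x" "0 \<le> y" for x y
  proof (rule order_antisym)
    show "r (x + y) \<le> r x + r y"
    proof (rule least)
      fix v assume "rk_value S (x + y) v"
      then obtain v1 v2 where "rk_value S x v1" "rk_value S y v2" "v = v1 + v2"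
        using rk_value_split xy by blast
      then show "v \<le> r x + r y" using up xy by (auto intro: add_mono)
    qed (use xy in simp)
    have "v + w \<le> r (x + y)" if "rk_value S x v" "rk_value S y w" for v w
      using up[OF _ rk_value.add[OF that]] xy by simp
    then have "w \<le> r (x + y) - v" if "rk_value S x v" "rk_value S y w" for v w
      using that by (simp add: algebra_simps)
    then have "r y \<le> r (x + y) - v" if "rk_value S x v" for v
      using that xy by (intro least) auto
    then have "v \<le> r (x + y) - r y" if "rk_value S x v" for v
      using that by (simp add: algebra_simps)
    then have "r x \<le> r (x + y) - r y" using xy by (intro least) auto
    then show "r x + r y \<le> r (x + y)" by (simp add: algebra_simps)
  qed
  have r0: "r 0 = 0" using radd[of 0 0] by simp
  have rscale_le: "c *\<^sub>R r x \<le> r (c *\<^sub>R x)" if c: "0 < c" and x: "0 \<le> x" for c x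
  proof -
    have "r x \<le> inverse c *\<^sub>R r (c *\<^sub>R x)"
    proof (rule least[OF x])
      fix v assume "rk_value S x v"
      then have "c *\<^sub>R v \<le> r (c *\<^sub>R x)"
        using c x by (intro up rk_value_scale scaleR_nonneg_nonneg) auto
      then have "inverse c *\<^sub>R (c *\<^sub>R v) \<le> inverse c *\<^sub>R r (c *\<^sub>R x)"
        using c by (intro scaleR_left_mono) auto
      then show "v \<le> inverse c *\<^sub>R r (c *\<^sub>R x)" using c by simp
    qed
    then have "c *\<^sub>R r x \<le> c *\<^sub>R (inverse c *\<^sub>R r (c *\<^sub>R x))"
      using c by (intro scaleR_left_mono) auto
    then show ?thesis using c by simp
  qed
  have rscale: "r (c *\<^sub>R x) = c *\<^sub>R r x" if c: "0 \<le> c" and x: "0 \<le> x" for c x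
  proof (cases "c = 0")
    case False
    with c have c: "0 < c" by simp
    have "inverse c *\<^sub>R r (c *\<^sub>R x) \<le> r (inverse c *\<^sub>R (c *\<^sub>R x))"
      using c x by (intro rscale_le scaleR_nonneg_nonneg) auto
    then have "c *\<^sub>R (inverse c *\<^sub>R r (c *\<^sub>R x)) \<le> c *\<^sub>R r x"
      using c by (intro scaleR_left_mono) auto
    then have "r (c *\<^sub>R x) \<le> c *\<^sub>R r x" using c by simp
    with rscale_le[OF c x] show ?thesis by simp
  qed (simp add: r0)
  obtain R where R: "linear R" "\<And>x. 0 \<le> x \<Longrightarrow> R x = r x"
    using cone_map_extension[OF radd rscale] by blast
  have ge: "regop_apply T x \<le> R x" if "T \<in> S" "0 \<le> x" for T x
    using up[OF that(2) rk_value.base[OF that]] R that by simp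
  have "positive_op (\<lambda>x. R x - regop_apply T0 x)"
    using ge[OF T0] R(1) linear_regop_apply[of T0]
    by (auto simp: positive_op_def intro: linear_compose_sub)
  then have "regular_op (\<lambda>x. (R x - regop_apply T0 x) + regop_apply T0 x)"
    by (intro regular_op_add regular_op_positive regular_op_regop_apply)
  then have RR: "regop_apply (Regop R) = R" by (simp add: Regop_inverse)
  have "\<forall>T\<in>S. T \<le> Regop R" using ge by (auto simp: regop_le_iff RR)
  moreover have "Regop R \<le> V" if "\<forall>T\<in>S. T \<le> V" for V
    unfolding regop_le_iff RR
  proof (intro allI impI)
    fix x :: 'a assume x: "0 \<le> x"
    have "r x \<le> regop_apply V x" using that by (intro least[OF x] rk_value_upper) auto
    then show "R x \<le> regop_apply V x" using R(2)[OF x] by simp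
  qed
  ultimately show ?thesis by blast
qed

lemma regop_bounded_pair:
  fixes S T :: "('a::riesz_space, 'b::riesz_space) regop"
  shows "\<exists>U. S \<le> U \<and> T \<le> U"
proof -
  obtain P Q where P: "positive_op P" "positive_op Q" "\<And>x. regop_apply S x = P x - Q x"
    using regular_op_regop_apply[of S] by (auto elim: regular_opE)
  obtain P' Q' where P': "positive_op P'" "positive_op Q'" "\<And>x. regop_apply T x = P' x - Q' x"
    using regular_op_regop_apply[of T] by (auto elim: regular_opE)
  have "regop_apply (Regop (\<lambda>x. P x + P' x)) = (\<lambda>x. P x + P' x)"
    using P P' by (simp add: Regop_inverse regular_op_positive positive_op_add)
  moreover have "P x - Q x \<le> P x + P' x" "P' x - Q' x \<le> P x + P' x" if "0 \<le> x" for x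
  proof -
    have nn: "0 \<le> P x" "0 \<le> Q x" "0 \<le> P' x" "0 \<le> Q' x"
      using P P' that by (auto simp: positive_op_def)
    have "P x - Q x \<le> P x" "P' x - Q' x \<le> P' x" using nn by simp_all
    then show "P x - Q x \<le> P x + P' x" "P' x - Q' x \<le> P x + P' x"
      using nn by (meson add_increasing add_increasing2 order_trans)+
  qed
  ultimately have "S \<le> Regop (\<lambda>x. P x + P' x)" "T \<le> Regop (\<lambda>x. P x + P' x)"
    unfolding regop_le_iff P(3) P'(3) by presburger+
  then show ?thesis by blast
qed

text \<open>
  \<open>sup S T\<close> is the least upper bound for the operator order; the description below is
  well-defined by the preceding lemma (see \<open>sup_regop_lub\<close>).
\<close>

instantiation regop :: (riesz_space, dedekind_complete_riesz_space) riesz_space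
begin

definition sup_regop :: "('a, 'b) regop \<Rightarrow> ('a, 'b) regop \<Rightarrow> ('a, 'b) regop" where
  "sup_regop S T = (THE R. S \<le> R \<and> T \<le> R \<and> (\<forall>V. S \<le> V \<and> T \<le> V \<longrightarrow> R \<le> V))"

definition inf_regop :: "('a, 'b) regop \<Rightarrow> ('a, 'b) regop \<Rightarrow> ('a, 'b) regop" where
  "inf_regop S T = - sup (- S) (- T)"

definition abs_regop :: "('a, 'b) regop \<Rightarrow> ('a, 'b) regop" where
  "abs_regop T = sup T (- T)"

lemma sup_regop_lub:
  "S \<le> sup S T \<and> T \<le> sup S T \<and> (\<forall>V. S \<le> V \<and> T \<le> V \<longrightarrow> sup S T \<le> V)"
  for S T :: "('a, 'b) regop"
  unfolding sup_regop_def
proof (rule theI')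
  obtain U where "S \<le> U" "T \<le> U" using regop_bounded_pair by blast
  then obtain R where "S \<le> R \<and> T \<le> R \<and> (\<forall>V. S \<le> V \<and> T \<le> V \<longrightarrow> R \<le> V)"
    using regop_dedekind_complete[of "{S, T}" U] by auto
  then show "\<exists>!R. S \<le> R \<and> T \<le> R \<and> (\<forall>V. S \<le> V \<and> T \<le> V \<longrightarrow> R \<le> V)"
    by (intro ex1I[of _ R]) (auto intro: order_antisym)
qed

instance
proof
  fix S T U :: "('a, 'b) regop"
  show "S \<le> sup S T" "T \<le> sup S T" using sup_regop_lub by blast+
  show "S \<le> U \<Longrightarrow> T \<le> U \<Longrightarrow> sup S T \<le> U" using sup_regop_lub by blast
  show "inf S T \<le> S" "inf S T \<le> T"
    unfolding inf_regop_def using sup_regop_lub[of "- S" "- T"] by (simp_all add: minus_le_iff)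
  show "S \<le> T \<Longrightarrow> S \<le> U \<Longrightarrow> S \<le> inf T U"
    unfolding inf_regop_def using sup_regop_lub[of "- T" "- U"]
    by (metis le_minus_iff neg_le_iff_le)
  show "\<bar>S\<bar> = sup S (- S)" by (rule abs_regop_def)
qed

end

instance regop :: (riesz_space, dedekind_complete_riesz_space) dedekind_complete_riesz_space
  by standard (use regop_dedekind_complete in \<open>auto simp: bdd_above_def\<close>)

section \<open>Two-sided multiplication operators\<close>

lift_definition regop_compose ::
  "('b::riesz_space, 'c::riesz_space) regop \<Rightarrow> ('a::riesz_space, 'b) regop \<Rightarrow> ('a, 'c) regop"
  is "\<lambda>S T x. S (T x)"
  by (rule regular_op_comp)

definition two_sided_mult ::
  "('y::dedekind_complete_riesz_space, 'z::dedekind_complete_riesz_space) regop \<Rightarrow>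
   ('w::riesz_space, 'x::riesz_space) regop \<Rightarrow>
   (('x, 'y) regop, ('w, 'z) regop) regop" where
  "two_sided_mult A B = Regop (\<lambda>T. regop_compose A (regop_compose T B))"

text \<open>
  \<^const>\<open>Regop\<close> is only specified on regular operators, so it has to be shown that
  \<open>T \<mapsto> A T B\<close> is one.
\<close>

lemma regular_op_two_sided_mult:
  fixes A :: "('y::dedekind_complete_riesz_space, 'z::dedekind_complete_riesz_space) regop"
    and B :: "('w::riesz_space, 'x::riesz_space) regop"
  shows "regular_op (\<lambda>T::('x, 'y) regop. regop_compose A (regop_compose T B))"
proof -
  obtain P Q where P: "positive_op P" "positive_op Q" "\<And>y. regop_apply A y = P y - Q y"
    using regular_op_regop_apply[of A] by (auto elim: regular_opE)
  obtain P' Q' where P': "positive_op P'" "positive_op Q'" "\<And>w. regop_apply B w = P' w - Q' w"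
    using regular_op_regop_apply[of B] by (auto elim: regular_opE)
  define M where "M C D T = regop_compose (Regop C) (regop_compose T (Regop D))"
    for C :: "'y \<Rightarrow> 'z" and D :: "'w \<Rightarrow> 'x" and T
  have M: "regop_apply (M C D T) w = C (regop_apply T (D w))"
    if "positive_op C" "positive_op D" for C D T w
    using that by (simp add: M_def regop_compose.rep_eq Regop_inverse regular_op_positive)
  have Mpos: "positive_op (M C D)" if CD: "positive_op C" "positive_op D" for C D
    unfolding positive_op_def
  proof
    have "linear C" using CD by (simp add: positive_op_def)
    then show "linear (M C D)"
      by (intro linearI regop_eqI)
        (simp_all add: M[OF CD] plus_regop.rep_eq scaleR_regop.rep_eq linear_add linear_scale)
    show "\<forall>T\<ge>0. 0 \<le> M C D T"
      using CD by (auto simp: regop_le_iff M zero_regop.rep_eq positive_op_def)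
  qed
  have lin: "linear P" "linear Q" using P by (auto simp: positive_op_def)
  show ?thesis
  proof (rule regular_opI)
    show "positive_op (\<lambda>T. M P P' T + M Q Q' T)" "positive_op (\<lambda>T. M P Q' T + M Q P' T)"
      using P P' by (intro positive_op_add Mpos; simp)+
    show "regop_compose A (regop_compose T B) = (M P P' T + M Q Q' T) - (M P Q' T + M Q P' T)"
      for T :: "('x, 'y) regop"
      using P(1,2) P'(1,2) lin
      by (intro regop_eqI)
        (simp add: M plus_regop.rep_eq minus_regop.rep_eq regop_compose.rep_eq P(3) P'(3)
          linear_diff[OF linear_regop_apply] linear_diff)
  qed
qed

lemma two_sided_mult_apply:
  "regop_apply (two_sided_mult A B) T = regop_compose A (regop_compose T B)"
  by (simp add: two_sided_mult_def Regop_inverse regular_op_two_sided_mult)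

end

theory Submission
  imports Defs
begin

text \<open>
  The inequality \<open>\<bar>M A B\<bar> \<le> M \<bar>A\<bar> \<bar>B\<bar>\<close> between two-sided
  multiplications is the pointwise estimate \<open>\<bar>A T B w\<bar> \<le> \<bar>A\<bar> T \<bar>B\<bar> w\<close> for
  \<open>T, w \<ge> 0\<close>. For the converse, put \<open>N = \<bar>M A B\<bar>\<close>. All that is used about \<open>N\<close> is that it is
  additive and that \<open>\<bar>A S B w\<bar> \<le> N(S) w\<close> for all \<open>S, w \<ge> 0\<close>. The estimate is improved by
  cutting the operator \<open>T\<close> and the vector \<open>w\<close> into pieces and adding up, in three stages.

  \<^item> If \<open>u = S B w \<ge> 0\<close> and \<open>u = u\<^sub>1 + \<dots> + u\<^sub>n\<close> with \<open>u\<^sub>i \<ge> 0\<close>, then there are positive operators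
    \<open>P\<^sub>i\<close> on \<open>Y\<close> with sum \<open>I\<close> and \<open>P\<^sub>i u = u\<^sub>i\<close>. Adding the estimates for the operators \<open>P\<^sub>i S\<close> gives
    \<open>\<Sum>\<bar>A u\<^sub>i\<bar> \<le> N(S) w\<close>. The supremum of these sums is \<open>\<bar>A\<bar> u\<close> (\<open>abs_regop_least\<close>), so
    \<open>\<bar>A\<bar> S B w \<le> N(S) w\<close>.
  \<^item> If \<open>Q + Q' = I\<close> are positive operators on \<open>X\<close> that cut \<open>B w\<close> into its positive part and the
    negative of its negative part, then the first stage applies to \<open>T Q\<close> and, with the opposite sign, to
    \<open>T Q'\<close>. Adding up gives \<open>\<bar>A\<bar> T \<bar>B w\<bar> \<le> N(T) w\<close> (\<open>abs_regop_le_functional\<close>).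
  \<^item> Writing \<open>w = w\<^sub>1 + \<dots> + w\<^sub>n\<close> with \<open>w\<^sub>i \<ge> 0\<close> and adding up gives \<open>\<bar>A\<bar> T d \<le> N(T) w\<close> for
    \<open>d = \<Sum>\<bar>B w\<^sub>i\<bar>\<close>. These \<open>d\<close> form an upward directed set with supremum \<open>\<bar>B\<bar> w\<close>. The norm of
    \<open>X\<close> is order continuous, so the positive operator \<open>\<bar>A\<bar> T\<close> respects the supremum
    (\<open>order_continuous_image_bound\<close>), whence \<open>\<bar>A\<bar> T \<bar>B\<bar> w \<le> N(T) w\<close>.

  The operators \<open>P\<^sub>i\<close>, \<open>Q\<close>, \<open>Q'\<close> are often taken from the theory of band projections. Here a single
  statement suffices: for \<open>0 \<le> a \<le> u\<close> there is an operator \<open>0 \<le> P \<le> I\<close> with \<open>P u = a\<close>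
  (\<open>identity_split\<close>). It is an instance of the Hahn--Banach theorem with values in a Dedekind
  complete space, since \<open>0 \<le> P \<le> I\<close> says that the linear map \<open>P\<close> is dominated by the
  sublinear map \<open>y \<mapsto> y\<^sup>+\<close>.
\<close>

section \<open>The Hahn--Banach--Kantorovich theorem\<close>

definition sublinear :: "('a::real_vector \<Rightarrow> 'b::riesz_space) \<Rightarrow> bool" where
  "sublinear p \<longleftrightarrow> (\<forall>x y. p (x + y) \<le> p x + p y) \<and> (\<forall>t>0. \<forall>x. p (t *\<^sub>R x) \<le> t *\<^sub>R p x)"

lemma sublinear_add: "sublinear p \<Longrightarrow> p (x + y) \<le> p x + p y"
  by (simp add: sublinear_def)

lemma sublinear_pos_scale:
  assumes "sublinear p" "0 < t"
  shows "p (t *\<^sub>R x) = t *\<^sub>R p x"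
proof (rule order_antisym)
  show "p (t *\<^sub>R x) \<le> t *\<^sub>R p x" using assms by (simp add: sublinear_def)
  have "p (inverse t *\<^sub>R t *\<^sub>R x) \<le> inverse t *\<^sub>R p (t *\<^sub>R x)"
    using assms unfolding sublinear_def by (meson positive_imp_inverse_positive)
  then have "t *\<^sub>R p x \<le> t *\<^sub>R (inverse t *\<^sub>R p (t *\<^sub>R x))"
    using assms(2) by (intro scaleR_left_mono) auto
  then show "t *\<^sub>R p x \<le> p (t *\<^sub>R x)" using assms(2) by simp
qed

lemma sublinear_zero: "sublinear p \<Longrightarrow> p 0 = 0"
  using sublinear_pos_scale[of p 2 0] by (simp add: scaleR_2)

lemma sublinear_minus: "sublinear p \<Longrightarrow> - p (- x) \<le> p x"
  using sublinear_add[of p x "- x"] diff_le_eq[of 0 "p (- x)" "p x"] by (simp add: sublinear_zero)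

text \<open>
  For negative \<open>t\<close> this is \<open>0 = p 0 \<le> p z + p (- z)\<close>. It says that the linear map
  \<open>t x \<mapsto> t p x\<close> on the line spanned by \<open>x\<close> is dominated by \<open>p\<close>.
\<close>

lemma sublinear_scale_lower:
  assumes "sublinear p"
  shows "t *\<^sub>R p x \<le> p (t *\<^sub>R x)"
proof (cases t "0::real" rule: linorder_cases)
  case less
  have "t *\<^sub>R p x = - p (- t *\<^sub>R x)"
    using sublinear_pos_scale[OF assms, of "- t" x] less by simp
  also have "\<dots> \<le> p (t *\<^sub>R x)" using sublinear_minus[OF assms, of "t *\<^sub>R x"] by simp
  finally show ?thesis .
qed (simp_all add: sublinear_zero[OF assms] sublinear_pos_scale[OF assms])

lemma dedekind_complete_inf:
  fixes S :: "'a::dedekind_complete_riesz_space set"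
  assumes "S \<noteq> {}" "\<And>x. x \<in> S \<Longrightarrow> l \<le> x"
  shows "\<exists>s. (\<forall>x\<in>S. s \<le> x) \<and> (\<forall>u. (\<forall>x\<in>S. u \<le> x) \<longrightarrow> u \<le> s)"
proof -
  have "bdd_above (uminus ` S)" using assms(2) by (intro bdd_aboveI[of _ "- l"]) auto
  then obtain s where s: "\<And>x. x \<in> S \<Longrightarrow> - x \<le> s" "\<And>u. (\<forall>x\<in>S. - x \<le> u) \<Longrightarrow> s \<le> u"
    using dedekind_complete[of "uminus ` S"] assms(1) by auto
  have "- s \<le> x" if "x \<in> S" for x using s(1)[OF that] by (simp add: minus_le_iff)
  moreover have "u \<le> - s" if "\<forall>x\<in>S. u \<le> x" for u
    using s(2)[of "- u"] that by (simp add: le_minus_iff)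
  ultimately show ?thesis by blast
qed

text \<open>
  Only two kinds of families occur: chains of sublinear maps, where \<open>h\<close> is the smaller of \<open>f\<close>
  and \<open>g\<close>, and the shifts \<open>y \<mapsto> p (y + t x) - t c\<close> of one sublinear map, where the parameters
  add up.
\<close>

lemma pointwise_inf_sublinear:
  fixes F :: "('a::real_vector \<Rightarrow> 'b::dedekind_complete_riesz_space) set"
  assumes ne: "F \<noteq> {}"
    and lower: "\<And>f x. f \<in> F \<Longrightarrow> l x \<le> f x"
    and add: "\<And>f g x y. f \<in> F \<Longrightarrow> g \<in> F \<Longrightarrow> \<exists>h\<in>F. h (x + y) \<le> f x + g y"
    and scale: "\<And>f t x. f \<in> F \<Longrightarrow> 0 < t \<Longrightarrow> \<exists>h\<in>F. h (t *\<^sub>R x) \<le> t *\<^sub>R f x"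
  obtains m where "sublinear m" "\<And>f x. f \<in> F \<Longrightarrow> m x \<le> f x"
proof -
  have "\<exists>s. (\<forall>f\<in>F. s \<le> f x) \<and> (\<forall>u. (\<forall>f\<in>F. u \<le> f x) \<longrightarrow> u \<le> s)" for x
    using dedekind_complete_inf[of "(\<lambda>f. f x) ` F" "l x"] ne lower by auto
  then obtain m where "\<And>x. (\<forall>f\<in>F. m x \<le> f x) \<and> (\<forall>u. (\<forall>f\<in>F. u \<le> f x) \<longrightarrow> u \<le> m x)"
    by metis
  then have m: "\<And>f x. f \<in> F \<Longrightarrow> m x \<le> f x"
    and greatest: "\<And>u x. (\<And>f. f \<in> F \<Longrightarrow> u \<le> f x) \<Longrightarrow> u \<le> m x"
    by blast+
  have sum: "m (x + y) \<le> f x + g y" if "f \<in> F" "g \<in> F" for f g x y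
    using add[OF that, of x y] m order_trans by blast
  have "m (x + y) - g y \<le> m x" if "g \<in> F" for g x y
    using sum[OF _ that] by (intro greatest) (simp add: diff_le_eq)
  then have "m (x + y) - m x \<le> m y" for x y
    by (intro greatest) (simp add: diff_le_eq add.commute)
  then have "m (x + y) \<le> m x + m y" for x y by (simp add: diff_le_eq add.commute)
  moreover have "m (t *\<^sub>R x) \<le> t *\<^sub>R m x" if t: "0 < t" for t x
  proof -
    have "inverse t *\<^sub>R m (t *\<^sub>R x) \<le> m x"
    proof (rule greatest)
      fix f assume "f \<in> F"
      then have "m (t *\<^sub>R x) \<le> t *\<^sub>R f x" using scale[OF _ t, of f x] m order_trans by blast
      then have "inverse t *\<^sub>R m (t *\<^sub>R x) \<le> inverse t *\<^sub>R (t *\<^sub>R f x)"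
        using t by (intro scaleR_left_mono) auto
      then show "inverse t *\<^sub>R m (t *\<^sub>R x) \<le> f x" using t by simp
    qed
    then have "t *\<^sub>R (inverse t *\<^sub>R m (t *\<^sub>R x)) \<le> t *\<^sub>R m x"
      using t by (intro scaleR_left_mono) auto
    then show ?thesis using t by simp
  qed
  ultimately have "sublinear m" by (simp add: sublinear_def)
  then show ?thesis using m that by blast
qed

text \<open>
  The infimum over \<open>t\<close> of \<open>p (y + t x) - t c\<close> is the largest sublinear map below \<open>p\<close> with
  value at most \<open>c\<close> at \<open>x\<close> and at most \<open>- c\<close> at \<open>- x\<close>. The choices \<open>t = 0\<close>, \<open>- 1\<close>, \<open>1\<close> give these
  three bounds. The hypothesis makes \<open>- p (- y)\<close> a lower bound of the family.
\<close>

lemma sublinear_minorant_with_value: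
  fixes p :: "'a::real_vector \<Rightarrow> 'b::dedekind_complete_riesz_space"
  assumes p: "sublinear p" and c: "\<And>t. t *\<^sub>R c \<le> p (t *\<^sub>R x)"
  obtains m where "sublinear m" "\<And>t y. m y \<le> p (y + t *\<^sub>R x) - t *\<^sub>R c"
proof -
  define F where "F = range (\<lambda>t y. p (y + t *\<^sub>R x) - t *\<^sub>R c)"
  have mem: "(\<lambda>y. p (y + t *\<^sub>R x) - t *\<^sub>R c) \<in> F" for t by (simp add: F_def)
  show ?thesis
  proof (rule pointwise_inf_sublinear[of F "\<lambda>y. - p (- y)"])
    show "F \<noteq> {}" by (simp add: F_def)
  next
    fix f y assume "f \<in> F"
    then obtain t where f: "f = (\<lambda>y. p (y + t *\<^sub>R x) - t *\<^sub>R c)" by (auto simp: F_def)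
    have "t *\<^sub>R c \<le> p ((y + t *\<^sub>R x) + - y)" using c[of t] by simp
    also have "\<dots> \<le> p (y + t *\<^sub>R x) + p (- y)" by (rule sublinear_add[OF p])
    finally show "- p (- y) \<le> f y" by (simp add: f algebra_simps minus_le_iff)
  next
    fix f g y z assume "f \<in> F" "g \<in> F"
    then obtain s t where f: "f = (\<lambda>y. p (y + s *\<^sub>R x) - s *\<^sub>R c)"
      and g: "g = (\<lambda>y. p (y + t *\<^sub>R x) - t *\<^sub>R c)" by (auto simp: F_def)
    have "p (y + z + (s + t) *\<^sub>R x) - (s + t) *\<^sub>R c \<le> f y + g z"
      using sublinear_add[OF p, of "y + s *\<^sub>R x" "z + t *\<^sub>R x"]
      by (simp add: f g algebra_simps)
    then show "\<exists>h\<in>F. h (y + z) \<le> f y + g z" by (rule bexI[OF _ mem])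
  next
    fix f and t :: real and y assume "f \<in> F" "0 < t"
    then obtain s where f: "f = (\<lambda>y. p (y + s *\<^sub>R x) - s *\<^sub>R c)" by (auto simp: F_def)
    have "p (t *\<^sub>R y + (t * s) *\<^sub>R x) - (t * s) *\<^sub>R c \<le> t *\<^sub>R f y"
      using sublinear_pos_scale[OF p \<open>0 < t\<close>, of "y + s *\<^sub>R x"]
      by (simp add: f algebra_simps)
    then show "\<exists>h\<in>F. h (t *\<^sub>R y) \<le> t *\<^sub>R f y" by (rule bexI[OF _ mem])
  next
    fix m assume "sublinear m" "\<And>f y. f \<in> F \<Longrightarrow> m y \<le> f y"
    then show thesis using that mem by blast
  qed
qed

text \<open>
  The minorant of \<open>q\<close> with value \<open>c = q x\<close> at \<open>x\<close> is \<open>q\<close> itself by minimality, and its bound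
  at \<open>t = 1\<close> is then superadditivity of \<open>q\<close>.
\<close>

lemma minimal_sublinear_is_linear:
  fixes q :: "'a::real_vector \<Rightarrow> 'b::dedekind_complete_riesz_space"
  assumes q: "sublinear q" and minimal: "\<And>m. sublinear m \<Longrightarrow> m \<le> q \<Longrightarrow> m = q"
  shows "linear q"
proof -
  have "q y + q x \<le> q (y + x)" for x y
  proof -
    obtain m where m: "sublinear m" "\<And>t y. m y \<le> q (y + t *\<^sub>R x) - t *\<^sub>R q x"
      using sublinear_minorant_with_value[OF q sublinear_scale_lower[OF q, of _ x]] by blast
    have "m y \<le> q y" for y using m(2)[of y 0] by simp
    then have "m = q" using minimal m(1) by (simp add: le_fun_def)
    then show ?thesis using m(2)[of y 1] by (simp add: le_diff_eq)
  qed
  then have add: "q (x + y) = q x + q y" for x y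
    using sublinear_add[OF q] by (intro order_antisym) auto
  have minus: "q (- x) = - q x" for x
    using add[of x "- x"] by (simp add: sublinear_zero[OF q] eq_neg_iff_add_eq_0 add.commute)
  show ?thesis
  proof (rule linearI[OF add])
    fix t :: real and x
    show "q (t *\<^sub>R x) = t *\<^sub>R q x"
    proof (cases t "0::real" rule: linorder_cases)
      case less
      then show ?thesis
        using sublinear_pos_scale[OF q, of "- t" x] minus[of "t *\<^sub>R x"] by simp
    qed (simp_all add: sublinear_zero[OF q] sublinear_pos_scale[OF q])
  qed
qed

text \<open>
  By Zorn's lemma there is a minimal sublinear map below \<open>p\<close>. Chains are bounded because every
  sublinear \<open>f \<le> p\<close> satisfies \<open>- p (- x) \<le> - f (- x) \<le> f x\<close>.
\<close>

lemma linear_below_sublinear: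
  fixes p :: "'a::real_vector \<Rightarrow> 'b::dedekind_complete_riesz_space"
  assumes p: "sublinear p"
  obtains L where "linear L" "\<And>x. L x \<le> p x"
proof -
  define A where "A = {q. sublinear q \<and> q \<le> p}"
  have "\<exists>q\<in>A. \<forall>a\<in>A. q \<ge> a \<longrightarrow> a = q"
  proof (rule predicate_Zorn)
    show "partial_order_on A (relation_of (\<ge>) A)"
      by (rule partial_order_on_relation_ofI) auto
  next
    fix C assume "C \<in> Chains (relation_of (\<ge>) A)"
    then have CA: "C \<subseteq> A" and chain: "\<And>q r. q \<in> C \<Longrightarrow> r \<in> C \<Longrightarrow> q \<le> r \<or> r \<le> q"
      by (auto simp: Chains_def relation_of_def)
    show "\<exists>u\<in>A. \<forall>a\<in>C. u \<le> a"
    proof (cases "C = {}")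
      case True
      then show ?thesis using p by (auto simp: A_def)
    next
      case False
      then obtain m where m: "sublinear m" "\<And>f x. f \<in> C \<Longrightarrow> m x \<le> f x"
      proof (rule pointwise_inf_sublinear[of C "\<lambda>x. - p (- x)"])
        fix f x assume "f \<in> C"
        then have f: "sublinear f" "f (- x) \<le> p (- x)" using CA by (auto simp: A_def le_fun_def)
        have "- p (- x) \<le> - f (- x)" using f(2) by simp
        also have "\<dots> \<le> f x" by (rule sublinear_minus[OF f(1)])
        finally show "- p (- x) \<le> f x" .
      next
        fix f g x y assume fg: "f \<in> C" "g \<in> C"
        then have sub: "sublinear f" "sublinear g" using CA by (auto simp: A_def)
        from chain[OF fg] show "\<exists>h\<in>C. h (x + y) \<le> f x + g y"
        proof
          assume "f \<le> g"
          then have "f x + f y \<le> f x + g y" by (simp add: le_fun_def)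
          then show ?thesis using fg sublinear_add[OF sub(1)] order_trans by blast
        next
          assume "g \<le> f"
          then have "g x + g y \<le> f x + g y" by (simp add: le_fun_def)
          then show ?thesis using fg sublinear_add[OF sub(2)] order_trans by blast
        qed
      next
        fix f and t :: real and x assume "f \<in> C" "0 < t"
        then show "\<exists>h\<in>C. h (t *\<^sub>R x) \<le> t *\<^sub>R f x"
          using CA by (intro bexI[of _ f]) (auto simp: A_def sublinear_def)
      qed blast
      obtain f where f: "f \<in> C" using False by blast
      have "m \<le> f" using m(2) f by (simp add: le_fun_def)
      also have "f \<le> p" using f CA by (auto simp: A_def)
      finally have "m \<in> A" using m(1) by (simp add: A_def)
      then show ?thesis using m(2) by (auto simp: le_fun_def)
    qed
  qed
  then obtain q where q: "sublinear q" "q \<le> p" "\<And>a. a \<in> A \<Longrightarrow> a \<le> q \<Longrightarrow> a = q"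
    by (auto simp: A_def)
  have "linear q"
    using q order_trans by (intro minimal_sublinear_is_linear) (auto simp: A_def)
  then show ?thesis using q(2) that by (auto simp: le_fun_def)
qed

text \<open>
  The extension from the line spanned by \<open>x\<close> is obtained by first lowering \<open>p\<close> until its values
  at \<open>x\<close> and \<open>- x\<close> force the value \<open>c\<close> on every linear minorant.
\<close>

theorem hahn_banach_kantorovich:
  fixes p :: "'a::real_vector \<Rightarrow> 'b::dedekind_complete_riesz_space"
  assumes p: "sublinear p" and c: "\<And>t. t *\<^sub>R c \<le> p (t *\<^sub>R x)"
  obtains L where "linear L" "\<And>y. L y \<le> p y" "L x = c"
proof -
  obtain m where m: "sublinear m" "\<And>t y. m y \<le> p (y + t *\<^sub>R x) - t *\<^sub>R c"
    using sublinear_minorant_with_value[OF p c] by blast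
  obtain L where L: "linear L" "\<And>y. L y \<le> m y" using linear_below_sublinear[OF m(1)] by blast
  have "L y \<le> p y" for y using L(2)[of y] m(2)[of y 0] by simp
  moreover have "L x = c"
  proof (rule order_antisym)
    show "L x \<le> c" using L(2)[of x] m(2)[of x "-1"] by (simp add: sublinear_zero[OF p])
    have "L (- x) \<le> - c" using L(2)[of "- x"] m(2)[of "- x" 1] by (simp add: sublinear_zero[OF p])
    then show "c \<le> L x" by (simp add: linear_neg[OF L(1)])
  qed
  ultimately show ?thesis using that L(1) by blast
qed

section \<open>Splitting the identity\<close>

lemma regop_nonneg_iff: "0 \<le> T \<longleftrightarrow> (\<forall>x\<ge>0. 0 \<le> regop_apply T x)"
  by (simp add: regop_le_iff zero_regop.rep_eq)

lemma regop_mono: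
  assumes "0 \<le> T" "x \<le> y"
  shows "regop_apply T x \<le> regop_apply T y"
proof -
  have "0 \<le> regop_apply T (y - x)" using assms by (simp add: regop_nonneg_iff)
  then show ?thesis by (simp add: linear_diff[OF linear_regop_apply])
qed

lemma sublinear_pprt: "sublinear (pprt :: 'a::riesz_space \<Rightarrow> 'a)"
proof -
  have "pprt (x + y) \<le> pprt x + pprt y" for x y :: 'a
    unfolding pprt_def by (intro sup_least add_mono add_nonneg_nonneg) auto
  moreover have "pprt (t *\<^sub>R x) \<le> t *\<^sub>R pprt x" if "0 < t" for t and x :: 'a
    using that unfolding pprt_def
    by (intro sup_least scaleR_left_mono scaleR_nonneg_nonneg) auto
  ultimately show ?thesis by (simp add: sublinear_def)
qed

text \<open>
  The linear map \<open>P\<close> extends \<open>t u \<mapsto> t a\<close> and is dominated by \<open>y \<mapsto> y\<^sup>+\<close>. For \<open>y \<ge> 0\<close>, domination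
  at \<open>y\<close> gives \<open>P y \<le> y\<close> and domination at \<open>- y\<close> gives \<open>0 \<le> P y\<close>. For continuous functions
  one may think of \<open>P\<close> as multiplication by \<open>a / u\<close>.
\<close>

lemma identity_split:
  fixes a u :: "'a::dedekind_complete_riesz_space"
  assumes "0 \<le> a" "a \<le> u"
  obtains P P' :: "('a, 'a) regop" where "0 \<le> P" "0 \<le> P'"
    "\<And>y. regop_apply P y + regop_apply P' y = y" "regop_apply P u = a"
proof -
  have "t *\<^sub>R a \<le> pprt (t *\<^sub>R u)" for t
  proof (cases "0 \<le> t")
    case True
    then have "t *\<^sub>R a \<le> t *\<^sub>R u" using assms by (intro scaleR_left_mono)
    then show ?thesis using le_supI1 unfolding pprt_def by blast
  next
    case False
    then have "t *\<^sub>R a \<le> 0" using assms(1) by (simp add: scaleR_nonpos_nonneg)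
    then show ?thesis using zero_le_pprt order_trans by blast
  qed
  then obtain L where L: "linear L" "\<And>y. L y \<le> pprt y" "L u = a"
    using hahn_banach_kantorovich[OF sublinear_pprt] by blast
  have le: "L y \<le> y" if "0 \<le> y" for y using L(2)[of y] that by simp
  have ge: "0 \<le> L y" if "0 \<le> y" for y
  proof -
    have "L (- y) \<le> 0" using L(2)[of "- y"] that by simp
    then show ?thesis by (simp add: linear_neg[OF L(1)])
  qed
  have "positive_op L" "positive_op (\<lambda>y. y - L y)"
    using L(1) le ge linear_compose_sub[OF linear_ident L(1)] by (auto simp: positive_op_def)
  then have R: "regop_apply (Regop L) = L" "regop_apply (Regop (\<lambda>y. y - L y)) = (\<lambda>y. y - L y)"
    by (auto intro!: Regop_inverse regular_op_positive)
  show ?thesis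
    by (rule that[of "Regop L" "Regop (\<lambda>y. y - L y)"]) (auto simp: regop_nonneg_iff R le ge L(3))
qed

section \<open>The modulus as a supremum of variation sums\<close>

text \<open>
  The sums \<open>\<Sum>\<bar>B x\<^sub>i\<bar>\<close> with \<open>x\<^sub>i \<ge> 0\<close> and \<open>\<Sum>x\<^sub>i = x\<close>. Unlike the Riesz--Kantorovich values
  \<open>\<Sum>\<plusminus>B x\<^sub>i\<close>, they form an upward directed set, which is what order continuity needs.
\<close>

inductive variation_sum :: "('a::riesz_space, 'b::riesz_space) regop \<Rightarrow> 'a \<Rightarrow> 'b \<Rightarrow> bool"
  for B where
  base: "0 \<le> x \<Longrightarrow> variation_sum B x \<bar>regop_apply B x\<bar>"
| add: "variation_sum B x v \<Longrightarrow> variation_sum B y w \<Longrightarrow> variation_sum B (x + y) (v + w)"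

lemma variation_sum_nonneg: "variation_sum B x v \<Longrightarrow> 0 \<le> x"
  by (induction rule: variation_sum.induct) auto

lemma regop_add: "regop_apply T (x + y) = regop_apply T x + regop_apply T y"
  by (rule linear_add[OF linear_regop_apply])

lemma abs_le_variation_sum: "variation_sum B x v \<Longrightarrow> \<bar>regop_apply B x\<bar> \<le> v"
proof (induction rule: variation_sum.induct)
  case (add x v y w)
  have "\<bar>regop_apply B (x + y)\<bar> \<le> \<bar>regop_apply B x\<bar> + \<bar>regop_apply B y\<bar>"
    unfolding regop_add by (rule abs_triangle_ineq)
  also have "\<dots> \<le> v + w" using add.IH by (rule add_mono)
  finally show ?case .
qed simp

text \<open>
  By the Riesz decomposition property, a decomposition of \<open>x + y\<close> is refined by one of \<open>x\<close>
  together with one of \<open>y\<close>; refining does not decrease the sum, by the triangle inequality.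
\<close>

lemma variation_sum_split:
  assumes "variation_sum B z v" "0 \<le> x" "0 \<le> y" "z = x + y"
  shows "\<exists>v1 v2. variation_sum B x v1 \<and> variation_sum B y v2 \<and> v \<le> v1 + v2"
  using assms
proof (induction arbitrary: x y rule: variation_sum.induct)
  case (base z)
  then show ?case
    using variation_sum.base[of x B] variation_sum.base[of y B] abs_triangle_ineq
    by (auto simp: regop_add)
next
  case (add p v q w)
  have "0 \<le> p" "0 \<le> q" using add.hyps variation_sum_nonneg by auto
  with add.prems obtain p1 p2 q1 q2 where
    *: "0 \<le> p1" "0 \<le> p2" "0 \<le> q1" "0 \<le> q2" "p = p1 + p2" "q = q1 + q2" "x = p1 + q1" "y = p2 + q2"
    using riesz_decomposition[of p q x y] by metis
  obtain v1 v2 where v: "variation_sum B p1 v1" "variation_sum B p2 v2" "v \<le> v1 + v2"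
    using add.IH(1)[OF *(1,2,5)] by blast
  obtain w1 w2 where w: "variation_sum B q1 w1" "variation_sum B q2 w2" "w \<le> w1 + w2"
    using add.IH(2)[OF *(3,4,6)] by blast
  have "variation_sum B x (v1 + w1)" "variation_sum B y (v2 + w2)"
    unfolding * using v w by (auto intro: variation_sum.add)
  moreover have "v + w \<le> (v1 + w1) + (v2 + w2)"
    using add_mono[OF v(3) w(3)] by (simp add: algebra_simps)
  ultimately show ?case by blast
qed

text \<open>
  Two decompositions have a common refinement: the second one is split along each piece of the
  first.
\<close>

lemma variation_sum_directed:
  assumes "variation_sum B x v" "variation_sum B x w"
  shows "\<exists>u. variation_sum B x u \<and> v \<le> u \<and> w \<le> u"
  using assms
proof (induction arbitrary: w rule: variation_sum.induct)
  case (base x)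
  then show ?case using abs_le_variation_sum by blast
next
  case (add x v1 y v2)
  obtain w1 w2 where w: "variation_sum B x w1" "variation_sum B y w2" "w \<le> w1 + w2"
    using variation_sum_split[OF add.prems] add.hyps variation_sum_nonneg by blast
  obtain u1 where u1: "variation_sum B x u1" "v1 \<le> u1" "w1 \<le> u1" using add.IH(1)[OF w(1)] by blast
  obtain u2 where u2: "variation_sum B y u2" "v2 \<le> u2" "w2 \<le> u2" using add.IH(2)[OF w(2)] by blast
  have "variation_sum B (x + y) (u1 + u2)" using u1(1) u2(1) by (rule variation_sum.add)
  moreover have "v1 + v2 \<le> u1 + u2" using u1(2) u2(2) by (rule add_mono)
  moreover have "w \<le> u1 + u2" using w(3) add_mono[OF u1(3) u2(3)] by (rule order_trans)
  ultimately show ?case by blast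
qed

lemma abs_scaleR_nonneg:
  fixes v :: "'a::riesz_space"
  assumes "0 \<le> c"
  shows "\<bar>c *\<^sub>R v\<bar> = c *\<^sub>R \<bar>v\<bar>"
proof -
  have le: "\<bar>c *\<^sub>R v\<bar> \<le> c *\<^sub>R \<bar>v\<bar>" if "0 \<le> c" for c and v :: 'a
  proof (rule abs_leI)
    show "c *\<^sub>R v \<le> c *\<^sub>R \<bar>v\<bar>" using that by (intro scaleR_left_mono abs_ge_self)
    have "c *\<^sub>R (- v) \<le> c *\<^sub>R \<bar>v\<bar>" using that by (intro scaleR_left_mono abs_ge_minus_self)
    then show "- (c *\<^sub>R v) \<le> c *\<^sub>R \<bar>v\<bar>" by simp
  qed
  show ?thesis
  proof (cases "c = 0")
    case False
    have "c *\<^sub>R \<bar>inverse c *\<^sub>R c *\<^sub>R v\<bar> \<le> c *\<^sub>R inverse c *\<^sub>R \<bar>c *\<^sub>R v\<bar>"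
      using assms by (intro scaleR_left_mono le) auto
    then have "c *\<^sub>R \<bar>v\<bar> \<le> \<bar>c *\<^sub>R v\<bar>" using False by simp
    with le[OF assms] show ?thesis by (rule order_antisym)
  qed simp
qed

lemma variation_sum_scale:
  "variation_sum B x v \<Longrightarrow> 0 \<le> c \<Longrightarrow> variation_sum B (c *\<^sub>R x) (c *\<^sub>R v)"
proof (induction rule: variation_sum.induct)
  case (base x)
  then have "variation_sum B (c *\<^sub>R x) \<bar>regop_apply B (c *\<^sub>R x)\<bar>"
    by (intro variation_sum.base scaleR_nonneg_nonneg)
  with base show ?case by (simp add: linear_scale[OF linear_regop_apply] abs_scaleR_nonneg)
next
  case (add x v y w)
  then show ?case by (simp add: scaleR_add_right variation_sum.add)
qed

lemma abs_regop_apply_le: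
  fixes B :: "('a::riesz_space, 'b::dedekind_complete_riesz_space) regop"
  assumes "0 \<le> x"
  shows "\<bar>regop_apply B x\<bar> \<le> regop_apply \<bar>B\<bar> x"
proof (rule abs_leI)
  show "regop_apply B x \<le> regop_apply \<bar>B\<bar> x"
    using abs_ge_self[of B] assms by (simp add: regop_le_iff)
  show "- regop_apply B x \<le> regop_apply \<bar>B\<bar> x"
    using abs_ge_minus_self[of B] assms by (simp add: regop_le_iff uminus_regop.rep_eq)
qed

lemma variation_sum_le_abs:
  fixes B :: "('a::riesz_space, 'b::dedekind_complete_riesz_space) regop"
  shows "variation_sum B x v \<Longrightarrow> v \<le> regop_apply \<bar>B\<bar> x"
  by (induction rule: variation_sum.induct) (auto simp: regop_add abs_regop_apply_le intro: add_mono)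

text \<open>
  With \<open>variation_sum_le_abs\<close>, this says that \<open>\<bar>B\<bar> x\<close> is the supremum of the variation sums at \<open>x\<close>.
  That supremum, as a function of \<open>x \<ge> 0\<close>, is additive and positively homogeneous, so
  it extends to a positive operator dominating \<open>B\<close> and \<open>- B\<close>, hence also \<open>\<bar>B\<bar>\<close>.
\<close>

lemma abs_regop_least:
  fixes B :: "('a::riesz_space, 'b::dedekind_complete_riesz_space) regop"
  assumes x: "0 \<le> x" and u: "\<And>v. variation_sum B x v \<Longrightarrow> v \<le> u"
  shows "regop_apply \<bar>B\<bar> x \<le> u"
proof -
  have "\<exists>s. (\<forall>v. variation_sum B x v \<longrightarrow> v \<le> s) \<and>
      (\<forall>u. (\<forall>v. variation_sum B x v \<longrightarrow> v \<le> u) \<longrightarrow> s \<le> u)" if "0 \<le> x" for x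
  proof -
    have "{v. variation_sum B x v} \<noteq> {}" using variation_sum.base[OF that] by blast
    moreover have "bdd_above {v. variation_sum B x v}"
      using variation_sum_le_abs by (intro bdd_aboveI) blast
    ultimately show ?thesis using dedekind_complete[of "{v. variation_sum B x v}"] by simp
  qed
  then obtain r where
    up: "\<And>x v. 0 \<le> x \<Longrightarrow> variation_sum B x v \<Longrightarrow> v \<le> r x" and
    least: "\<And>x u. 0 \<le> x \<Longrightarrow> (\<And>v. variation_sum B x v \<Longrightarrow> v \<le> u) \<Longrightarrow> r x \<le> u"
    by metis
  have radd: "r (x + y) = r x + r y" if xy: "0 \<le> x" "0 \<le> y" for x y
  proof (rule order_antisym)
    show "r (x + y) \<le> r x + r y"
    proof (rule least)
      fix v assume "variation_sum B (x + y) v"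
      then obtain v1 v2 where "variation_sum B x v1" "variation_sum B y v2" "v \<le> v1 + v2"
        using variation_sum_split xy by blast
      then show "v \<le> r x + r y" using up xy by (meson add_mono order_trans)
    qed (use xy in simp)
    have "w \<le> r (x + y) - v" if "variation_sum B x v" "variation_sum B y w" for v w
      using up[OF _ variation_sum.add[OF that]] xy by (simp add: algebra_simps)
    then have "r y \<le> r (x + y) - v" if "variation_sum B x v" for v
      using that xy by (intro least) auto
    then have "r x \<le> r (x + y) - r y" using xy by (intro least) (auto simp: algebra_simps)
    then show "r x + r y \<le> r (x + y)" by (simp add: algebra_simps)
  qed
  have rscale_le: "r (c *\<^sub>R x) \<le> c *\<^sub>R r x" if c: "0 < c" and x: "0 \<le> x" for c x
  proof (rule least)
    show "0 \<le> c *\<^sub>R x" using c x by (intro scaleR_nonneg_nonneg) auto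
    fix v assume "variation_sum B (c *\<^sub>R x) v"
    then have "variation_sum B x (inverse c *\<^sub>R v)"
      using variation_sum_scale[of B "c *\<^sub>R x" v "inverse c"] c by simp
    then have "c *\<^sub>R (inverse c *\<^sub>R v) \<le> c *\<^sub>R r x"
      using c by (intro scaleR_left_mono up[OF x]) auto
    then show "v \<le> c *\<^sub>R r x" using c by simp
  qed
  have rscale: "r (c *\<^sub>R x) = c *\<^sub>R r x" if c: "0 \<le> c" and x: "0 \<le> x" for c x
  proof (cases "c = 0")
    case True
    then show ?thesis using radd[of 0 0] by simp
  next
    case False
    with c have c: "0 < c" by simp
    have "c *\<^sub>R r (inverse c *\<^sub>R (c *\<^sub>R x)) \<le> c *\<^sub>R inverse c *\<^sub>R r (c *\<^sub>R x)"
      using c x by (intro scaleR_left_mono rscale_le scaleR_nonneg_nonneg) auto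
    then have "c *\<^sub>R r x \<le> r (c *\<^sub>R x)" using c by simp
    with rscale_le[OF c x] show ?thesis by simp
  qed
  obtain R where R: "linear R" "\<And>x. 0 \<le> x \<Longrightarrow> R x = r x"
    using cone_map_extension[OF radd rscale] by blast
  have ge: "\<bar>regop_apply B x\<bar> \<le> R x" if "0 \<le> x" for x
    using up[OF that variation_sum.base[OF that]] R(2)[OF that] by simp
  then have "positive_op R"
    using R(1) abs_ge_zero order_trans unfolding positive_op_def by blast
  then have RR: "regop_apply (Regop R) = R" by (simp add: Regop_inverse regular_op_positive)
  have "\<bar>B\<bar> \<le> Regop R"
    using ge by (intro abs_leI) (auto simp: regop_le_iff RR uminus_regop.rep_eq abs_le_iff)
  then have "regop_apply \<bar>B\<bar> x \<le> R x" using x by (simp add: regop_le_iff RR)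
  also have "\<dots> \<le> u" using R(2)[OF x] least[OF x u] by simp
  finally show ?thesis .
qed

section \<open>Bounding the modulus of the left factor\<close>

lemma regop_compose_apply: "regop_apply (regop_compose S T) x = regop_apply S (regop_apply T x)"
  by (simp add: regop_compose.rep_eq)

lemma regop_compose_nonneg: "0 \<le> S \<Longrightarrow> 0 \<le> T \<Longrightarrow> 0 \<le> regop_compose S T"
  by (simp add: regop_nonneg_iff regop_compose_apply)

text \<open>
  In the application \<open>x = B w\<close> and \<open>f S = N(S) w\<close>. A decomposition \<open>S x = p + q\<close> into positive
  vectors is realised by a decomposition \<open>S = P S + P' S\<close> into positive operators, where \<open>P\<close>
  and \<open>P'\<close> split the identity and map \<open>p + q\<close> to \<open>p\<close> and \<open>q\<close>. Hence the hypothesis can be applied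
  to each piece and added up.
\<close>

lemma variation_sum_le_functional:
  fixes f :: "('x::riesz_space, 'y::dedekind_complete_riesz_space) regop \<Rightarrow> 'z::riesz_space"
    and A :: "('y, 'z) regop"
  assumes add: "\<And>S T. f (S + T) = f S + f T"
    and bound: "\<And>S. 0 \<le> S \<Longrightarrow> \<bar>regop_apply A (regop_apply S x)\<bar> \<le> f S"
    and "variation_sum A u d" "0 \<le> S" "regop_apply S x = u"
  shows "d \<le> f S"
  using assms(3-)
proof (induction arbitrary: S rule: variation_sum.induct)
  case (base u)
  then show ?case using bound by auto
next
  case (add p v q w)
  have "0 \<le> p" "p \<le> p + q" using add.hyps variation_sum_nonneg by auto
  then obtain P P' :: "('y, 'y) regop" where P: "0 \<le> P" "0 \<le> P'"
    "\<And>y. regop_apply P y + regop_apply P' y = y" "regop_apply P (p + q) = p"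
    using identity_split by metis
  have P'q: "regop_apply P' (p + q) = q" using P(3)[of "p + q"] P(4) by simp
  have S: "S = regop_compose P S + regop_compose P' S"
    by (rule regop_eqI) (simp add: plus_regop.rep_eq regop_compose_apply P(3))
  have "v \<le> f (regop_compose P S)"
    using add.prems P by (intro add.IH(1) regop_compose_nonneg) (auto simp: regop_compose_apply)
  moreover have "w \<le> f (regop_compose P' S)"
    using add.prems P P'q by (intro add.IH(2) regop_compose_nonneg) (auto simp: regop_compose_apply)
  ultimately show ?case using S assms(1) by (metis add_mono)
qed

lemma abs_eq_pprt_add_pprt_minus: "\<bar>x\<bar> = pprt x + pprt (- x :: 'a::riesz_space)"
  using abs_prts[of x] by (simp add: pprt_neg)

lemma inf_pprt_pprt_minus: "inf (pprt x) (pprt (- x)) = (0::'a::riesz_space)"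
proof -
  have "sup (pprt x) (pprt (- x)) = sup \<bar>x\<bar> 0"
    by (simp add: pprt_def abs_lattice sup_assoc sup_left_commute)
  also have "\<dots> = pprt x + pprt (- x)"
    by (simp add: sup_absorb1 flip: abs_eq_pprt_add_pprt_minus)
  finally show ?thesis using add_eq_inf_sup[of "pprt x" "pprt (- x)"] by simp
qed

text \<open>
  The variation sums of \<open>A\<close> reach \<open>\<bar>A\<bar> (S y)\<close> only when \<open>S y \<ge> 0\<close>. So \<open>T\<close> is cut
  into \<open>T Q + T Q'\<close> with \<open>Q x = x\<^sup>+\<close> and \<open>Q' (- x) = x\<^sup>-\<close>, and the previous bound is used with
  \<open>y = x\<close> and \<open>S = T Q\<close>, and with \<open>y = - x\<close> and \<open>S = T Q'\<close>. Such a \<open>Q\<close> comes from splitting the identity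
  so that \<open>Q \<bar>x\<bar> = x\<^sup>+\<close>.
\<close>

lemma abs_regop_le_functional:
  fixes f :: "('x::dedekind_complete_riesz_space, 'y::dedekind_complete_riesz_space) regop
      \<Rightarrow> 'z::dedekind_complete_riesz_space"
    and A :: "('y, 'z) regop"
  assumes add: "\<And>S T. f (S + T) = f S + f T"
    and bound: "\<And>S. 0 \<le> S \<Longrightarrow> \<bar>regop_apply A (regop_apply S x)\<bar> \<le> f S"
    and T: "0 \<le> T"
  shows "regop_apply \<bar>A\<bar> (regop_apply T \<bar>x\<bar>) \<le> f T"
proof -
  have pos: "regop_apply \<bar>A\<bar> (regop_apply S y) \<le> f S"
    if "0 \<le> S" "0 \<le> regop_apply S y" "y = x \<or> y = - x" for S y
  proof (rule abs_regop_least[OF that(2)])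
    fix d assume "variation_sum A (regop_apply S y) d"
    moreover have "\<bar>regop_apply A (regop_apply R y)\<bar> \<le> f R" if "0 \<le> R" for R
      using bound[OF that] \<open>y = x \<or> y = - x\<close> by (auto simp: linear_neg[OF linear_regop_apply])
    ultimately show "d \<le> f S" using variation_sum_le_functional add that(1) by blast
  qed
  have "0 \<le> pprt x" "pprt x \<le> \<bar>x\<bar>" by (simp_all add: pprt_def abs_ge_self)
  then obtain Q Q' :: "('x, 'x) regop" where Q: "0 \<le> Q" "0 \<le> Q'"
    "\<And>y. regop_apply Q y + regop_apply Q' y = y" "regop_apply Q \<bar>x\<bar> = pprt x"
    using identity_split by metis
  note ab = abs_eq_pprt_add_pprt_minus[of x]
  \<comment> \<open>\<open>Q x\<^sup>-\<close> lies below \<open>Q \<bar>x\<bar> = x\<^sup>+\<close> and below \<open>x\<^sup>-\<close>, which are disjoint.\<close>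
  have Qneg: "regop_apply Q (pprt (- x)) = 0"
  proof (rule order_antisym)
    have nonneg: "0 \<le> pprt x" "0 \<le> pprt (- x)" by (simp_all only: zero_le_pprt)
    then have "0 \<le> regop_apply Q (pprt x)" "0 \<le> regop_apply Q' (pprt (- x))"
      using Q(1,2) by (auto simp: regop_nonneg_iff)
    moreover have "regop_apply Q (pprt x) + regop_apply Q (pprt (- x)) = pprt x"
      using Q(4) by (simp only: ab regop_add)
    ultimately have "regop_apply Q (pprt (- x)) \<le> pprt x"
      "regop_apply Q (pprt (- x)) \<le> pprt (- x)"
      using Q(3)[of "pprt (- x)"] by (metis le_add_same_cancel2, metis le_add_same_cancel1)
    then show "regop_apply Q (pprt (- x)) \<le> 0"
      using inf_pprt_pprt_minus[of x] by (metis le_inf_iff)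
    show "0 \<le> regop_apply Q (pprt (- x))" using Q(1) by (simp add: regop_nonneg_iff)
  qed
  have "regop_apply Q (pprt x) = pprt x" using Q(4) Qneg by (simp only: ab regop_add add_0_right)
  then have Qx: "regop_apply Q x = pprt x"
    using Qneg linear_diff[OF linear_regop_apply, of Q "pprt x" "pprt (- x)"] riesz_pos_neg[of x]
    by simp
  have "regop_apply Q' x = x - pprt x" using Q(3)[of x] Qx by (metis add_diff_cancel_left')
  moreover have "pprt x = x + pprt (- x)" using riesz_pos_neg[of x] by (metis diff_add_cancel)
  ultimately have Q'x: "regop_apply Q' (- x) = pprt (- x)"
    by (simp add: linear_neg[OF linear_regop_apply])
  have Tpos: "0 \<le> regop_apply T y" if "0 \<le> y" for y using T that by (simp add: regop_nonneg_iff)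
  have TQ: "T = regop_compose T Q + regop_compose T Q'"
    by (rule regop_eqI) (simp add: plus_regop.rep_eq regop_compose_apply Q(3) flip: regop_add)
  have "regop_apply \<bar>A\<bar> (regop_apply T \<bar>x\<bar>)
      = regop_apply \<bar>A\<bar> (regop_apply (regop_compose T Q) x)
        + regop_apply \<bar>A\<bar> (regop_apply (regop_compose T Q') (- x))"
    by (simp only: ab regop_add regop_compose_apply Qx Q'x)
  also have "\<dots> \<le> f (regop_compose T Q) + f (regop_compose T Q')"
    using T Q(1,2) Tpos
    by (intro add_mono pos regop_compose_nonneg) (auto simp: regop_compose_apply Qx Q'x)
  also have "\<dots> = f T" using TQ add by metis
  finally show ?thesis .
qed

section \<open>Order continuity of positive operators\<close>

text \<open>
  A positive operator out of a Banach lattice with order continuous norm respects suprema of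
  directed sets. Order continuity provides \<open>d\<^sub>n\<close> in \<open>G\<close> with \<open>s - d\<^sub>n\<close> so small in norm
  that \<open>\<Sum>n (s - d\<^sub>n)\<close> converges, with sum \<open>g\<close>. Then \<open>n (C s - z) \<le> C (n (s - d\<^sub>n)) \<le> C g\<close> for
  all \<open>n\<close>, and \<open>C s \<le> z\<close> by the Archimedean property. The domination by \<open>g\<close> replaces the norm
  continuity of \<open>C\<close>.
\<close>

lemma order_continuous_image_bound:
  fixes C :: "('x::order_continuous_banach_lattice, 'z::banach_lattice) regop"
  assumes C: "0 \<le> C" and ne: "G \<noteq> {}"
    and directed: "\<And>c d. c \<in> G \<Longrightarrow> d \<in> G \<Longrightarrow> \<exists>e\<in>G. c \<le> e \<and> d \<le> e"
    and up: "\<And>d. d \<in> G \<Longrightarrow> d \<le> s"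
    and least: "\<And>u. (\<And>d. d \<in> G \<Longrightarrow> d \<le> u) \<Longrightarrow> s \<le> u"
    and z: "\<And>d. d \<in> G \<Longrightarrow> regop_apply C d \<le> z"
  shows "regop_apply C s \<le> z"
proof -
  define D where "D = (\<lambda>d. s - d) ` G"
  have small: "\<exists>d\<in>G. norm (s - d) < e" if "0 < e" for e
  proof -
    have "\<exists>v\<in>D. \<forall>x\<in>D. x \<le> v \<longrightarrow> norm x < e"
    proof (rule order_continuous_norm)
      show "D \<noteq> {}" using ne by (simp add: D_def)
      show "\<forall>x\<in>D. \<forall>y\<in>D. \<exists>z\<in>D. z \<le> x \<and> z \<le> y"
        using directed by (fastforce simp: D_def)
      show "\<forall>x\<in>D. 0 \<le> x" using up by (simp add: D_def)
      show "\<forall>w. (\<forall>x\<in>D. w \<le> x) \<longrightarrow> w \<le> 0"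
      proof (intro allI impI)
        fix w assume "\<forall>x\<in>D. w \<le> x"
        then have "s \<le> s - w" by (intro least) (simp add: D_def algebra_simps)
        then show "w \<le> 0" by simp
      qed
    qed (rule that)
    then show ?thesis by (auto simp: D_def)
  qed
  have "\<exists>d\<in>G. norm (s - d) < (1/2) ^ n / real (Suc n)" for n :: nat by (rule small) simp
  then obtain d where d: "\<And>n. d n \<in> G" "\<And>n. norm (s - d n) < (1/2) ^ n / real (Suc n)" by metis
  define h where "h n = real n *\<^sub>R (s - d n)" for n
  have h0: "0 \<le> h n" for n using up[OF d(1)] by (simp add: h_def scaleR_nonneg_nonneg)
  have "norm (h n) \<le> (1/2) ^ n" for n
  proof -
    have "norm (h n) \<le> real (Suc n) * norm (s - d n)" by (simp add: h_def mult_right_mono)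
    also have "\<dots> < (1/2) ^ n"
      using d(2)[of n] by (subst (asm) pos_less_divide_eq) (simp_all only: of_nat_0_less_iff zero_less_Suc mult.commute)
    finally show ?thesis by simp
  qed
  then have "summable h"
    by (intro summable_comparison_test[OF _ summable_geometric[of "1/2 :: real"]]) auto
  then obtain g where g: "(\<lambda>N. \<Sum>i<N. h i) \<longlonglongrightarrow> g" using summable_LIMSEQ by blast
  have hg: "h n \<le> g" for n
  proof -
    have "0 \<le> g - h n"
    proof (rule banach_lattice_nonneg_if_approx)
      fix e :: real assume "0 < e"
      then obtain N where N: "\<And>m. m \<ge> N \<Longrightarrow> norm ((\<Sum>i<m. h i) - g) < e" using g LIMSEQ_iff by metis
      define m where "m = max N (Suc n)"
      have "h n \<le> (\<Sum>i<m. h i)" using sum_mono2[of "{..<m}" "{n}" h] h0 by (simp add: m_def)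
      moreover have "norm ((\<Sum>i<m. h i) - g) < e" using N[of m] by (simp add: m_def)
      ultimately show "\<exists>y\<ge>0. norm (y - (g - h n)) < e"
        by (intro exI[of _ "(\<Sum>i<m. h i) - h n"]) auto
    qed
    then show ?thesis by simp
  qed
  have "of_nat n *\<^sub>R (regop_apply C s - z) \<le> regop_apply C g" for n :: nat
  proof -
    have "real n *\<^sub>R (regop_apply C s - z) \<le> real n *\<^sub>R (regop_apply C s - regop_apply C (d n))"
      using z[OF d(1)] by (intro scaleR_left_mono diff_left_mono) auto
    also have "\<dots> = regop_apply C (h n)"
      by (simp add: h_def linear_scale[OF linear_regop_apply] linear_diff[OF linear_regop_apply])
    also have "\<dots> \<le> regop_apply C g" using C hg by (rule regop_mono)
    finally show ?thesis by simp
  qed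
  then have "regop_apply C s - z \<le> 0" by (rule banach_lattice_archimedean)
  then show ?thesis by simp
qed

section \<open>Two-sided multiplication\<close>

lemma abs_regop_apply_le_abs:
  fixes R :: "('a::riesz_space, 'b::dedekind_complete_riesz_space) regop"
  shows "\<bar>regop_apply R x\<bar> \<le> regop_apply \<bar>R\<bar> \<bar>x\<bar>"
proof -
  have "regop_apply R x = regop_apply R (pprt x) - regop_apply R (pprt (- x))"
    using riesz_pos_neg[of x] by (metis linear_diff linear_regop_apply)
  then have "\<bar>regop_apply R x\<bar> \<le> \<bar>regop_apply R (pprt x)\<bar> + \<bar>regop_apply R (pprt (- x))\<bar>"
    using abs_triangle_ineq4 by simp
  also have "\<dots> \<le> regop_apply \<bar>R\<bar> (pprt x) + regop_apply \<bar>R\<bar> (pprt (- x))"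
    by (intro add_mono abs_regop_apply_le zero_le_pprt)
  also have "\<dots> = regop_apply \<bar>R\<bar> (pprt x + pprt (- x))" by (simp only: regop_add)
  finally show ?thesis by (simp only: abs_eq_pprt_add_pprt_minus)
qed

lemma abs_two_sided_mult_le:
  fixes A :: "('y::dedekind_complete_riesz_space, 'z::dedekind_complete_riesz_space) regop"
    and B :: "('w::riesz_space, 'x::dedekind_complete_riesz_space) regop"
  shows "\<bar>two_sided_mult A B\<bar> \<le> two_sided_mult \<bar>A\<bar> \<bar>B\<bar>"
proof -
  have le: "\<bar>regop_apply A (regop_apply T (regop_apply B w))\<bar>
      \<le> regop_apply \<bar>A\<bar> (regop_apply T (regop_apply \<bar>B\<bar> w))" if "0 \<le> T" "0 \<le> w" for T w
  proof -
    have "\<bar>regop_apply T (regop_apply B w)\<bar> \<le> regop_apply T \<bar>regop_apply B w\<bar>"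
      using abs_regop_apply_le_abs[of T] that(1) by (simp add: abs_of_nonneg)
    also have "\<dots> \<le> regop_apply T (regop_apply \<bar>B\<bar> w)"
      using that by (intro regop_mono abs_regop_apply_le)
    finally show ?thesis
      using abs_regop_apply_le_abs regop_mono[OF abs_ge_zero] order_trans by blast
  qed
  show ?thesis
    using le by (intro abs_leI)
      (auto simp: regop_le_iff two_sided_mult_apply regop_compose_apply uminus_regop.rep_eq abs_le_iff)
qed

theorem corollary2p3:
  fixes A :: "('y::order_continuous_banach_lattice,
               'z::{banach_lattice, dedekind_complete_riesz_space}) regop"
    and B :: "('w::banach_lattice, 'x::order_continuous_banach_lattice) regop"
  shows "\<bar>two_sided_mult A B\<bar> = two_sided_mult \<bar>A\<bar> \<bar>B\<bar>"
proof (rule order_antisym[OF abs_two_sided_mult_le])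
  define N where "N T w = regop_apply (regop_apply \<bar>two_sided_mult A B\<bar> T) w" for T w
  have N_add: "N (S + T) w = N S w + N T w" for S T w
    by (simp add: N_def regop_add plus_regop.rep_eq)
  have N_bound: "\<bar>regop_apply A (regop_apply S (regop_apply B w))\<bar> \<le> N S w"
    if "0 \<le> S" "0 \<le> w" for S w
    using abs_ge_self[of "two_sided_mult A B"] abs_ge_minus_self[of "two_sided_mult A B"] that
    by (intro abs_leI) (auto simp: N_def regop_le_iff two_sided_mult_apply regop_compose_apply
        uminus_regop.rep_eq)
  have "regop_apply \<bar>A\<bar> (regop_apply T (regop_apply \<bar>B\<bar> w)) \<le> N T w"
    if T: "0 \<le> T" and w: "0 \<le> w" for T w
  proof -
    have sum_le: "regop_apply \<bar>A\<bar> (regop_apply T d) \<le> N T v" if "variation_sum B v d" for v d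
      using that
    proof (induction rule: variation_sum.induct)
      case (base v)
      then show ?case using N_bound T by (intro abs_regop_le_functional N_add)
    next
      case (add v d v' d')
      then show ?case by (simp add: regop_add add_mono N_def)
    qed
    have "regop_apply (regop_compose \<bar>A\<bar> T) (regop_apply \<bar>B\<bar> w) \<le> N T w"
    proof (rule order_continuous_image_bound[where G = "{d. variation_sum B w d}"])
      show "0 \<le> regop_compose \<bar>A\<bar> T" using T by (intro regop_compose_nonneg abs_ge_zero)
      show "{d. variation_sum B w d} \<noteq> {}" using variation_sum.base[OF w] by blast
    qed (use variation_sum_directed sum_le in
        \<open>auto simp: regop_compose_apply intro: variation_sum_le_abs abs_regop_least[OF w]\<close>)
    then show ?thesis by (simp add: regop_compose_apply)
  qed
  then show "two_sided_mult \<bar>A\<bar> \<bar>B\<bar> \<le> \<bar>two_sided_mult A B\<bar>"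
    by (simp add: regop_le_iff[where 'a = "('x, 'y) regop"] regop_le_iff[where 'a = 'w]
        two_sided_mult_apply regop_compose_apply N_def)
qed

end
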